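(* Let $n\ge2$ and let $t$ be an odd divisor of $n$. Let $I_{n/t}^{(+1)}$ (resp. $I_{n/t}^{(0)}$) be the number of irreducible representations of $J_n=\mathbb{C}^{S_{n-1}}\#\mathbb{C}C_n$ of dimension $t$ with indicator $+1$ (resp. $0$), counted as in the context. Then $$I_{n/1}^{(+1)}=\sum_{j\in E_{n/1}}\alpha_{j,n/1}\qquad(t=1),$$ $$I_{n/t}^{(+1)}=t\sum_{j\in E_{n/t}}\sum_{r=1}^{t}\alpha_{j,n/t}\,|O_{n/t,r,j}|\qquad(1<t<n),$$ $$I_{n/n}^{(+1)}=n\sum_{r=1}^{n}|O_{n/n,r}|\qquad(t=n),$$ and the number of irreducible representations of $J_n$ of dimension $t$ with indicator $0$ is $$I_{n/t}^{(0)}=\frac nt|M_{n/t}|-I_{n/t}^{(+1)}.$$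
   Context: Identify $\{1,\dots,n\}$ with $\mathbb{Z}/n\mathbb{Z}$ (so $n=0$) and $S_n$ with the bijections of $\mathbb{Z}/n\mathbb{Z}$ under composition (right-to-left). $S_{n-1}$ is the subgroup of those $x$ with $x(n)=n$; $a=(1\,2\,\cdots\,n)$ is the shift $i\mapsto i+1$; $C_n=\langle a\rangle$. Values of permutations are computed modulo $n$. Each product $xa^r$ ($x\in S_{n-1}$) factors uniquely as $xa^r=(x\rhd a^r)(x\lhd a^r)$ with $x\rhd a^r\in C_n$, $x\lhd a^r\in S_{n-1}$; explicitly $x\rhd a^r=a^{x(r)}$ and $x\lhd a^r=a^{-x(r)}xa^r$. $\lhd$ is a right action of $C_n$ on the set $S_{n-1}$; $\mathcal{O}_x$ is the orbit and $F_x$ the stabilizer of $x$. Whenever we write $F_x=\langle a^t\rangle$, $t$ is the positive divisor of $n$ with this property; then $|\mathcal{O}_x|=t$. An involution is any $x\in S_{n-1}$ with $x^2=1$ (including the identity). $J_n$ is the semisimple Hopf algebra over $\mathbb{C}$ with basis $p_y\#b$ ($y\in S_{n-1}$, $b\in C_n$), product $(p_y\#b)(p_z\#c)=\delta_{z,\,y\lhd b}\,p_y\#bc$, unit $\sum_y p_y\#1$, counit $\varepsilon(p_y\#b)=\delta_{y,1}$, coproduct $\Delta(p_y\#b)=\sum_{z}(p_{yz^{-1}}\#(z\rhd b))\otimes(p_z\#b)$, antipode $S(p_y\#b)=p_{(y\lhd b)^{-1}}\#(y\rhd b)^{-1}$. For an irreducible representation $V$ of $F_x$, the induced irreducible $J_n$-module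 is $\hat V=\mathbb{C}C_n\otimes_{\mathbb{C}F_x}V$ with $(p_y\#b)\cdot(c\otimes v)=\delta_{y\lhd(bc),x}\,(bc\otimes v)$; its dimension is $[C_n:F_x]$. The Frobenius-Schur indicator of a $J_n$-module with character $\chi$ is $\nu(\chi)=\chi(\sum\Lambda_1\Lambda_2)$, where $\Lambda$ is the two-sided integral of $J_n$ with $\varepsilon(\Lambda)=1$ and $\Delta(\Lambda)=\sum\Lambda_1\otimes\Lambda_2$. Counting convention: the irreducible representations of dimension $t$ are counted as pairs $(x,\rho)$ with $x\in S_{n-1}$, $F_x=\langle a^t\rangle$, and $\rho$ one of the $n/t$ irreducible representations of $F_x$ (so all $t$ permutations in an orbit are counted separately); the indicator attached to $(x,\rho)$ is that of the $J_n$-module induced from $\rho$ via $x$. Notation: $E_{n/t}=\{1\le j\le\frac nt: j^2\equiv1\bmod\frac nt\}$; $\alpha_{j,n/t}=\gcd(j+1,\frac nt)$; $M_{n/t}=\{x\in S_{n-1}:F_x=\langle a^t\rangle\}$; $O_{n/t,r}$ is the set of orbits (of $C_n$ on $S_{n-1}$ under $\lhd$) of length $t$ containing exactly $r$ involutions; for $1<t<n$, $O_{n/t,r,j}$ is the set of orbits of length $t$ containing exactly $r$ involutions and such that $y(t)=jt$ for every $y$ in the orbit. *)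

theory Defs
  imports
    "HOL-Algebra.Sym_Groups"
    "HOL-Library.Function_Algebras"
    "HOL-Number_Theory.Cong"
    "Jordan_Normal_Form.VS_Connect"
begin

section \<open>The factorization of the symmetric group\<close>

text \<open>
  The group \<open>\<int>/n\<int>\<close> is represented by \<open>{1..n}\<close>, with \<open>n\<close> in the role of \<open>0\<close>; permutations are
  functions on \<open>nat\<close> that fix everything outside \<open>{1..n}\<close>. Equalities between values of
  permutations and residues modulo \<open>n\<close> are stated as congruences.
\<close>

type_synonym perm = "nat \<Rightarrow> nat"

definition shift :: "nat \<Rightarrow> perm" where
  "shift n i = (if i \<in> {1..n} then i mod n + 1 else i)"

definition Cyc :: "nat \<Rightarrow> perm set" where
  "Cyc n = generate (sym_group n) {shift n}"

definition Stb :: "nat \<Rightarrow> perm set" where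
  "Stb n = {x \<in> carrier (sym_group n). x n = n}"

text \<open>
  For \<open>x \<in> Stb n\<close> and \<open>b \<in> Cyc n\<close>, the product \<open>x \<circ> b\<close> factors uniquely as an element of \<open>Cyc n\<close>
  (this is \<open>lact n x b\<close>) followed on the right by an element of \<open>Stb n\<close> (this is \<open>ract n x b\<close>).
\<close>

definition lact :: "nat \<Rightarrow> perm \<Rightarrow> perm \<Rightarrow> perm" where
  "lact n x b = (THE c. c \<in> Cyc n \<and> (\<exists>y \<in> Stb n. x \<circ> b = c \<circ> y))"

definition ract :: "nat \<Rightarrow> perm \<Rightarrow> perm \<Rightarrow> perm" where
  "ract n x b = (THE y. y \<in> Stb n \<and> (\<exists>c \<in> Cyc n. x \<circ> b = c \<circ> y))"

definition orb :: "nat \<Rightarrow> perm \<Rightarrow> perm set" where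
  "orb n x = ract n x ` Cyc n"

definition stab :: "nat \<Rightarrow> perm \<Rightarrow> perm set" where
  "stab n x = {b \<in> Cyc n. ract n x b = x}"


section \<open>The Hopf algebra \<open>J n\<close>\<close>

text \<open>
  Vectors of a space with basis \<open>X\<close> are the functions into \<open>complex\<close> that vanish outside \<open>X\<close>,
  and \<open>bvec i\<close> is the basis vector belonging to \<open>i\<close>.
\<close>

definition cscale :: "complex \<Rightarrow> ('i \<Rightarrow> complex) \<Rightarrow> 'i \<Rightarrow> complex" where
  "cscale k f = (\<lambda>i. k * f i)"

global_interpretation cfun: vector_space "cscale :: complex \<Rightarrow> ('i \<Rightarrow> complex) \<Rightarrow> 'i \<Rightarrow> complex"
  by unfold_locales (auto simp: cscale_def fun_eq_iff algebra_simps)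

definition bvec :: "'i \<Rightarrow> 'i \<Rightarrow> complex" where
  "bvec i = (\<lambda>j. if j = i then 1 else 0)"

text \<open>The index pair \<open>(y, b)\<close> stands for the basis element \<open>p\<^sub>y # b\<close>.\<close>

type_synonym jvec = "perm \<times> perm \<Rightarrow> complex"

definition JB :: "nat \<Rightarrow> (perm \<times> perm) set" where
  "JB n = Stb n \<times> Cyc n"

definition J :: "nat \<Rightarrow> jvec set" where
  "J n = {h. \<forall>w. w \<notin> JB n \<longrightarrow> h w = 0}"

definition J_mult :: "nat \<Rightarrow> jvec \<Rightarrow> jvec \<Rightarrow> jvec" where
  "J_mult n f g = (\<Sum>(y, b) \<in> JB n. \<Sum>(z, c) \<in> JB n.
     cscale (f (y, b) * g (z, c)) (if z = ract n y b then bvec (y, b \<circ> c) else 0))"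

definition J_counit :: "nat \<Rightarrow> jvec \<Rightarrow> complex" where
  "J_counit n f = (\<Sum>(y, b) \<in> JB n. f (y, b) * (if y = id then 1 else 0))"

text \<open>The tensor square of \<open>J n\<close> has the basis \<open>JB n \<times> JB n\<close>.\<close>

definition J_comult :: "nat \<Rightarrow> jvec \<Rightarrow> (perm \<times> perm) \<times> (perm \<times> perm) \<Rightarrow> complex" where
  "J_comult n f = (\<Sum>(y, b) \<in> JB n. \<Sum>z \<in> Stb n.
     cscale (f (y, b)) (bvec ((y \<circ> inv' z, lact n z b), (z, b))))"

definition J_integral :: "nat \<Rightarrow> jvec" where
  "J_integral n = (THE L. L \<in> J n \<and> J_counit n L = 1 \<and>
     (\<forall>h \<in> J n. J_mult n h L = cscale (J_counit n h) L \<and> J_mult n L h = cscale (J_counit n h) L))"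

text \<open>The element \<open>\<Sum> \<Lambda>\<^sub>1 \<Lambda>\<^sub>2\<close>, that is, the multiplication applied to the coproduct of \<open>\<Lambda>\<close>.\<close>

definition J_integral_sq :: "nat \<Rightarrow> jvec" where
  "J_integral_sq n = (\<Sum>u \<in> JB n. \<Sum>v \<in> JB n.
     cscale (J_comult n (J_integral n) (u, v)) (J_mult n (bvec u) (bvec v)))"


section \<open>Irreducible representations of permutation groups\<close>

text \<open>A pair \<open>(d, \<rho>)\<close> is a representation on \<open>\<complex>\<^sup>d\<close>; the values of \<open>\<rho>\<close> outside the group are irrelevant.\<close>

type_synonym rep = "nat \<times> (perm \<Rightarrow> complex mat)"

definition is_rep :: "perm set \<Rightarrow> rep \<Rightarrow> bool" where
  "is_rep G = (\<lambda>(d, \<rho>). (\<forall>g \<in> G. \<rho> g \<in> carrier_mat d d) \<and> \<rho> id = 1\<^sub>m d \<and>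
     (\<forall>g \<in> G. \<forall>h \<in> G. \<rho> (g \<circ> h) = \<rho> g * \<rho> h))"

definition irr_reps :: "perm set \<Rightarrow> rep set" where
  "irr_reps G = {(d, \<rho>). is_rep G (d, \<rho>) \<and> d > 0 \<and>
     (\<forall>U. VectorSpace.subspace class_ring U (module_vec TYPE(complex) d) \<longrightarrow>
        (\<forall>g \<in> G. \<forall>u \<in> U. \<rho> g *\<^sub>v u \<in> U) \<longrightarrow> U = {0\<^sub>v d} \<or> U = carrier_vec d)}"

definition rep_iso :: "perm set \<Rightarrow> (rep \<times> rep) set" where
  "rep_iso G = {((d, \<rho>), (e, \<sigma>)). (d, \<rho>) \<in> irr_reps G \<and> (e, \<sigma>) \<in> irr_reps G \<and> d = e \<and>
     (\<exists>P \<in> carrier_mat d d. invertible_mat P \<and> (\<forall>g \<in> G. P * \<rho> g = \<sigma> g * P))}"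

definition irr_classes :: "perm set \<Rightarrow> rep set set" where
  "irr_classes G = irr_reps G // rep_iso G"


section \<open>Induced modules and their characters\<close>

text \<open>
  The trace of the endomorphism of \<open>W/R\<close> induced by \<open>f\<close>, where \<open>R \<subseteq> W\<close> are spaces stable under \<open>f\<close>
  and \<open>W/R\<close> is finite-dimensional. A basis of \<open>W/R\<close> is given by representatives in \<open>W\<close>; the trace
  does not depend on its choice.
\<close>

definition quot_coords ::
    "('i \<Rightarrow> complex) set \<Rightarrow> ('i \<Rightarrow> complex) set \<Rightarrow> ('i \<Rightarrow> complex) \<Rightarrow> (('i \<Rightarrow> complex) \<Rightarrow> complex) \<Rightarrow> bool" where
  "quot_coords R B w k \<longleftrightarrow> (\<forall>b. b \<notin> B \<longrightarrow> k b = 0) \<and> w - (\<Sum>b \<in> B. cscale (k b) b) \<in> R"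

definition quot_basis :: "('i \<Rightarrow> complex) set \<Rightarrow> ('i \<Rightarrow> complex) set \<Rightarrow> ('i \<Rightarrow> complex) set \<Rightarrow> bool" where
  "quot_basis W R B \<longleftrightarrow> finite B \<and> B \<subseteq> W \<and> (\<forall>w \<in> W. \<exists>!k. quot_coords R B w k)"

definition quot_trace ::
    "('i \<Rightarrow> complex) set \<Rightarrow> ('i \<Rightarrow> complex) set \<Rightarrow> (('i \<Rightarrow> complex) \<Rightarrow> 'i \<Rightarrow> complex) \<Rightarrow> complex" where
  "quot_trace W R f = (let B = (SOME B. quot_basis W R B) in
     \<Sum>b \<in> B. (THE k. quot_coords R B (f b) k) b)"

text \<open>
  For a representation \<open>(d, \<rho>)\<close> of \<open>F = stab n x\<close> on \<open>V = \<complex>\<^sup>d\<close>, the tensor product of \<open>\<complex>C\<^sub>n\<close> and \<open>V\<close>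
  over \<open>\<complex>F\<close> is the quotient of their tensor product over \<open>\<complex>\<close> (with basis \<open>Cyc n \<times> {..<d}\<close>) by the
  span of all \<open>c g \<otimes> v - c \<otimes> g v\<close>.
\<close>

type_synonym ivec = "perm \<times> nat \<Rightarrow> complex"

definition pure :: "perm \<Rightarrow> complex vec \<Rightarrow> ivec" where
  "pure c v = (\<Sum>i < dim_vec v. cscale (v $ i) (bvec (c, i)))"

definition ind_space :: "nat \<Rightarrow> rep \<Rightarrow> ivec set" where
  "ind_space n = (\<lambda>(d, \<rho>). {w. \<forall>p. p \<notin> Cyc n \<times> {..<d} \<longrightarrow> w p = 0})"

definition ind_rels :: "nat \<Rightarrow> perm \<Rightarrow> rep \<Rightarrow> ivec set" where
  "ind_rels n x = (\<lambda>(d, \<rho>). cfun.span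
     {pure (c \<circ> g) v - pure c (\<rho> g *\<^sub>v v) | c g v. c \<in> Cyc n \<and> g \<in> stab n x \<and> v \<in> carrier_vec d})"

text \<open>The action \<open>(p\<^sub>y # b) \<cdot> (c \<otimes> v) = \<delta> (bc \<otimes> v)\<close>, on representatives.\<close>

definition ind_act :: "nat \<Rightarrow> perm \<Rightarrow> rep \<Rightarrow> jvec \<Rightarrow> ivec \<Rightarrow> ivec" where
  "ind_act n x = (\<lambda>(d, \<rho>) h w. \<Sum>(y, b) \<in> JB n. \<Sum>(c, i) \<in> Cyc n \<times> {..<d}.
     cscale (h (y, b) * w (c, i)) (if ract n y (b \<circ> c) = x then bvec (b \<circ> c, i) else 0))"

definition ind_character :: "nat \<Rightarrow> perm \<Rightarrow> rep \<Rightarrow> jvec \<Rightarrow> complex" where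
  "ind_character n x V h = quot_trace (ind_space n V) (ind_rels n x V) (ind_act n x V h)"

definition fs_indicator :: "nat \<Rightarrow> perm \<Rightarrow> rep \<Rightarrow> complex" where
  "fs_indicator n x V = ind_character n x V (J_integral_sq n)"


section \<open>The counted quantities\<close>

text \<open>Here \<open>n\<close> and \<open>t\<close> are separate arguments where the usual notation has the index \<open>n/t\<close>.\<close>

definition M :: "nat \<Rightarrow> nat \<Rightarrow> perm set" where
  "M n t = {x \<in> Stb n. stab n x = generate (sym_group n) {shift n ^^ t}}"

text \<open>
  Irreducible representations of dimension \<open>t\<close> with indicator \<open>\<nu>\<close>, counted as pairs of \<open>x \<in> M n t\<close>
  and an isomorphism class of irreducible representations of the stabilizer of \<open>x\<close>.
\<close>

definition num_irr :: "nat \<Rightarrow> nat \<Rightarrow> complex \<Rightarrow> nat" where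
  "num_irr n t \<nu> = card {(x, K). x \<in> M n t \<and> K \<in> irr_classes (stab n x) \<and>
     (\<forall>V \<in> K. fs_indicator n x V = \<nu>)}"

definition E :: "nat \<Rightarrow> nat set" where
  "E m = {j \<in> {1..m}. [j\<^sup>2 = 1] (mod m)}"

definition alpha :: "nat \<Rightarrow> nat \<Rightarrow> nat" where
  "alpha j m = gcd (j + 1) m"

definition involutions :: "nat \<Rightarrow> perm set" where
  "involutions n = {x \<in> Stb n. x \<circ> x = id}"

definition orbits :: "nat \<Rightarrow> nat \<Rightarrow> nat \<Rightarrow> perm set set" where
  "orbits n t r = {Q \<in> orb n ` Stb n. card Q = t \<and> card (Q \<inter> involutions n) = r}"

definition orbits_at :: "nat \<Rightarrow> nat \<Rightarrow> nat \<Rightarrow> nat \<Rightarrow> perm set set" where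
  "orbits_at n t r j = {Q \<in> orbits n t r. \<forall>y \<in> Q. [y t = j * t] (mod n)}"

end

theory Submission
  imports Defs "HOL-Algebra.Multiplicative_Group" "Jordan_Normal_Form.Spectral_Radius"
begin

text \<open>
  Let \<open>a\<close> be the shift, \<open>F = \<langle>a\<^sup>t\<rangle>\<close> the stabilizer of \<open>x\<close> and \<open>m = n/t\<close>. As \<open>F\<close> is cyclic, its irreducible
  representations are the characters \<open>\<chi>\<close>, indexed by the \<open>m\<close>-th root of unity \<open>\<zeta> = \<chi>(a\<^sup>t)\<close>. The integral is
  \<open>\<Lambda> = (1/n) \<Sum>\<^sub>b p\<^sub>1 # b\<close>, and the indicator of the induced module becomes
  \<open>(1/n) \<Sum>\<^sub>y \<Sum>\<^sub>b \<chi>((y\<^sup>-\<^sup>1 \<rhd> b) b)\<close>, where \<open>y\<close> runs through the orbit of \<open>x\<close> and \<open>b\<close> through the solutions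
  of \<open>y\<^sup>-\<^sup>1 \<lhd> b = y\<close>.

  A solution puts \<open>y\<^sup>-\<^sup>1\<close> into the orbit, which is then closed under inversion; its length \<open>t\<close> being odd,
  it contains an involution. So the indicator is \<open>0\<close> if the orbit has no involution. If it contains the
  involution \<open>z\<close>, then \<open>z a\<^sup>t z\<^sup>-\<^sup>1 = a\<^bsup>jt\<^esup>\<close> with \<open>j\<^sup>2 \<equiv> 1\<close> modulo \<open>m\<close>; every \<open>y\<close> contributes
  \<open>(1/n) \<Sum>\<^sub>f \<chi>(f\<^bsup>j+1\<^esup>)\<close>, the sum over \<open>f \<in> F\<close>, and the indicator is \<open>1\<close> or \<open>0\<close> according to whether
  \<open>\<zeta>\<^bsup>j+1\<^esup> = 1\<close>. There are \<open>gcd (j + 1) m\<close> such \<open>\<zeta>\<close>. Summing over the orbits of length \<open>t\<close> proves the middle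
  formula for every \<open>t\<close>. For \<open>t = 1\<close> the orbits are the automorphisms \<open>i \<mapsto> ji\<close> of \<open>\<int>/n\<close>, one for
  each \<open>j\<close>, and for \<open>t = n\<close> only \<open>j = 1\<close> occurs.
\<close>

section \<open>Parity, residues and roots of unity\<close>

text \<open>The set falls into pairs \<open>{x, f x}\<close>; the induction removes one pair at a
  time. Its contrapositive yields a fixed point of inversion on an orbit of odd length.\<close>

lemma even_card_if_fixpoint_free_involution:
  assumes "finite A" "\<And>x. x \<in> A \<Longrightarrow> f x \<in> A \<and> f (f x) = x \<and> f x \<noteq> x"
  shows "even (card A)"
  using assms
proof (induction A rule: finite_psubset_induct)
  case (psubset A)
  show ?case
  proof (cases "A = {}")
    case False
    then obtain x where x: "x \<in> A" by blast
    have fx: "f x \<in> A" "f (f x) = x" "f x \<noteq> x" using psubset.prems[OF x] by auto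
    have "even (card (A - {x, f x}))"
    proof (rule psubset.IH)
      show "A - {x, f x} \<subset> A" using x by blast
      show "f y \<in> A - {x, f x} \<and> f (f y) = y \<and> f y \<noteq> y" if "y \<in> A - {x, f x}" for y
        using that psubset.prems[of y] fx by auto
    qed
    moreover have "card A = card (A - {x, f x}) + 2"
    proof -
      have "card (A - {x, f x}) = card A - card {x, f x}"
        using x fx by (intro card_Diff_subset) auto
      moreover have "card {x, f x} = 2" using fx by auto
      moreover have "card {x, f x} \<le> card A"
        using x fx psubset.hyps by (intro card_mono) auto
      ultimately show ?thesis by simp
    qed
    ultimately show ?thesis by simp
  qed simp
qed

lemma ex_cong_in_interval:
  fixes n m :: nat
  assumes "0 < n"
  shows "\<exists>i \<in> {1..n}. [m = i] (mod n)"
\<comment> \<open>The class of 0 is represented by \<open>n\<close>, so this residue cannot be taken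
  as \<open>m mod n\<close>.\<close>
proof (cases "m mod n = 0")
  case True
  then show ?thesis using assms by (intro bexI[of _ n]) (auto simp: cong_def)
next
  case False
  then show ?thesis using assms
    by (intro bexI[of _ "m mod n"]) (auto simp: cong_def less_imp_le Suc_leI)
qed

lemma cong_in_interval_imp_eq:
  fixes n i j :: nat
  assumes "i \<in> {1..n}" "j \<in> {1..n}" "[i = j] (mod n)"
  shows "i = j"
  using assms by (cases "i = n"; cases "j = n") (auto simp: cong_def)

lemma sum_powers_root_of_unity:
  fixes z :: complex
  assumes "z ^ m = 1"
  shows "(\<Sum>k < m. z ^ k) = (if z = 1 then of_nat m else 0)"
  using assms geometric_sum[of z m] by simp

lemma power_eq_if_cong:
  fixes z :: "'a :: monoid_mult"
  assumes "z ^ m = 1" "[k = l] (mod m)"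
  shows "z ^ k = z ^ l"
proof -
  have "z ^ k = z ^ (k mod m)" for k
  proof -
    have "z ^ k = z ^ (m * (k div m) + k mod m)" by simp
    also have "\<dots> = z ^ (k mod m)" by (simp only: power_add power_mult assms power_one mult_1)
    finally show ?thesis .
  qed
  then show ?thesis using assms(2) unfolding cong_def by metis
qed

text \<open>By Bezout the two equations together say that \<open>z\<close> is a root of unity of
  order dividing the gcd. This is the source of the factor \<open>alpha\<close>.\<close>

lemma card_common_roots_of_unity:
  assumes "0 < m"
  shows "card {z :: complex. z ^ m = 1 \<and> z ^ l = 1} = gcd l m"
proof -
  have "z ^ m = 1 \<and> z ^ l = 1 \<longleftrightarrow> z ^ gcd l m = 1" for z :: complex
  proof
    assume z: "z ^ m = 1 \<and> z ^ l = 1"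
    \<comment> \<open>Bezout's identity is taken in a form without subtraction, so that all
      exponents remain natural numbers.\<close>
    obtain x y where "m * x = l * y + gcd m l" using bezout_nat[of m l] assms by auto
    then have "z ^ (m * x) = z ^ (l * y) * z ^ gcd m l" by (simp add: power_add)
    with z show "z ^ gcd l m = 1" by (simp add: power_mult gcd.commute)
  next
    assume z: "z ^ gcd l m = 1"
    have "z ^ k = 1" if "gcd l m dvd k" for k
      using that z by (auto simp: power_mult elim!: dvdE)
    then show "z ^ m = 1 \<and> z ^ l = 1" by simp
  qed
  then show ?thesis using card_roots_unity_eq[of "gcd l m"] assms by simp
qed

section \<open>Traces on quotients\<close>

lemma sum_fun_apply: "(\<Sum>i\<in>A. f i) x = (\<Sum>i\<in>A. f i x)"
  by (induction A rule: infinite_finite_induct) auto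

lemma sum_cscale_bvec:
  assumes "finite A" "\<And>i. i \<notin> A \<Longrightarrow> w i = 0"
  shows "(\<Sum>i \<in> A. cscale (w i) (bvec i)) = w"
proof
  fix j
  have "(\<Sum>i \<in> A. cscale (w i) (bvec i)) j = (\<Sum>i \<in> A. if i = j then w j else 0)"
    unfolding sum_fun_apply by (intro sum.cong) (auto simp: cscale_def bvec_def)
  also have "\<dots> = w j" using assms by simp
  finally show "(\<Sum>i \<in> A. cscale (w i) (bvec i)) j = w j" .
qed

text \<open>The functionals \<open>\<phi> s\<close> identify \<open>W/R\<close> with the functions
  on \<open>S\<close>, with the classes of the \<open>e s\<close> as dual basis, and
  \<open>A\<close> is the matrix of \<open>f\<close> in these coordinates. As
  \<open>quot_trace\<close> is computed in an arbitrarily chosen basis, the proof contains the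
  independence of the trace from the basis.\<close>

lemma quot_trace_dual_basis:
  fixes \<phi> :: "'s \<Rightarrow> ('i \<Rightarrow> complex) \<Rightarrow> complex"
  assumes S: "finite S"
    and W: "cfun.subspace W"
    and e: "\<And>s. s \<in> S \<Longrightarrow> e s \<in> W"
    and dual: "\<And>r s. r \<in> S \<Longrightarrow> s \<in> S \<Longrightarrow> \<phi> r (e s) = (if r = s then 1 else 0)"
    and add: "\<And>s u v. s \<in> S \<Longrightarrow> \<phi> s (u + v) = \<phi> s u + \<phi> s v"
    and scale: "\<And>s k u. s \<in> S \<Longrightarrow> \<phi> s (cscale k u) = k * \<phi> s u"
    and R: "\<And>w. w \<in> W \<Longrightarrow> w \<in> R \<longleftrightarrow> (\<forall>s \<in> S. \<phi> s w = 0)"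
    and f: "\<And>w. w \<in> W \<Longrightarrow> f w \<in> W"
    and A: "\<And>r w. r \<in> S \<Longrightarrow> w \<in> W \<Longrightarrow> \<phi> r (f w) = (\<Sum>s \<in> S. A r s * \<phi> s w)"
  shows "quot_trace W R f = (\<Sum>s \<in> S. A s s)"
proof -
  have \<phi>_sum: "\<phi> s (\<Sum>b \<in> B. cscale (k b) (g b)) = (\<Sum>b \<in> B. k b * \<phi> s (g b))" if "s \<in> S" for s B k
    and g :: "'x \<Rightarrow> 'i \<Rightarrow> complex"
  proof (induction B rule: infinite_finite_induct)
    case (infinite B)
    then show ?case using scale[OF that, of 0 0] by (simp add: cscale_def zero_fun_def)
  next
    case empty
    then show ?case using scale[OF that, of 0 0] by (simp add: cscale_def zero_fun_def)
  next
    case (insert b B)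
    then show ?case unfolding sum.insert[OF insert(1,2)] add[OF that] scale[OF that] by simp
  qed
  have \<phi>_diff: "\<phi> s (u - v) = \<phi> s u - \<phi> s v" if "s \<in> S" for s u v
    using add[OF that, of "u - v" v] by simp
  have coords: "quot_coords R B w k \<longleftrightarrow>
      (\<forall>b. b \<notin> B \<longrightarrow> k b = 0) \<and> (\<forall>s \<in> S. \<phi> s w = (\<Sum>b \<in> B. k b * \<phi> s b))"
    if "B \<subseteq> W" "w \<in> W" for B w k
  proof -
    have "(\<Sum>b \<in> B. cscale (k b) b) \<in> W"
      using that W by (intro cfun.subspace_sum cfun.subspace_scale) auto
    then have "w - (\<Sum>b \<in> B. cscale (k b) b) \<in> W" using that W by (intro cfun.subspace_diff)
    from R[OF this] show ?thesis
      unfolding quot_coords_def by (auto simp: \<phi>_diff \<phi>_sum)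
  qed
  have inj: "inj_on e S"
    using dual by (metis inj_onI zero_neq_one)
  \<comment> \<open>This basis only shows that the choice made by \<open>SOME\<close> succeeds; the
    chosen basis \<open>B\<close> below may be a different one.\<close>
  have "quot_basis W R (e ` S)"
    unfolding quot_basis_def
  proof (intro conjI ballI)
    fix w assume w: "w \<in> W"
    have sum_eq: "(\<Sum>b \<in> e ` S. k b * \<phi> s b) = k (e s)" if "s \<in> S" for k s
    proof -
      have "(\<Sum>b \<in> e ` S. k b * \<phi> s b) = (\<Sum>r \<in> S. if r = s then k (e r) else 0)"
        unfolding sum.reindex[OF inj] using that by (auto simp: dual intro!: sum.cong)
      then show ?thesis using S that by simp
    qed
    have *: "quot_coords R (e ` S) w k \<longleftrightarrow>
        (\<forall>b. b \<notin> e ` S \<longrightarrow> k b = 0) \<and> (\<forall>s \<in> S. \<phi> s w = k (e s))" for k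
      using coords[OF _ w, of "e ` S"] e by (auto simp: sum_eq)
    show "\<exists>!k. quot_coords R (e ` S) w k"
    proof (rule ex1I)
      show "quot_coords R (e ` S) w (\<lambda>b. if b \<in> e ` S then \<phi> (the_inv_into S e b) w else 0)"
        unfolding * by (auto simp: the_inv_into_f_f[OF inj])
    next
      fix k assume "quot_coords R (e ` S) w k"
      then show "k = (\<lambda>b. if b \<in> e ` S then \<phi> (the_inv_into S e b) w else 0)"
        unfolding * by (auto simp: the_inv_into_f_f[OF inj] fun_eq_iff)
    qed
  qed (use S e in auto)
  then have basis: "quot_basis W R (SOME B. quot_basis W R B)" by (rule someI)
  define B where "B = (SOME B. quot_basis W R B)"
  have "quot_basis W R B" using basis unfolding B_def .
  then have B: "finite B" "B \<subseteq> W" "\<And>w. w \<in> W \<Longrightarrow> \<exists>!k. quot_coords R B w k"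
    unfolding quot_basis_def by auto
  define K where "K w = (THE k. quot_coords R B w k)" for w
  have K: "quot_coords R B w (K w)" if "w \<in> W" for w
    unfolding K_def using B(3)[OF that] by (rule theI')
  have \<phi>_K: "\<phi> s w = (\<Sum>b \<in> B. K w b * \<phi> s b)" if "s \<in> S" "w \<in> W" for s w
    using K[OF that(2)] coords[OF B(2) that(2)] that(1) by auto
  \<comment> \<open>Change of basis: modulo \<open>R\<close>, \<open>w\<close> is the combination of
    the \<open>e s\<close> with coefficients \<open>\<phi> s w\<close>, so its coordinates in
    \<open>B\<close> follow from those of the \<open>e s\<close>.\<close>
  have K_e: "K w b = (\<Sum>s \<in> S. \<phi> s w * K (e s) b)" if "w \<in> W" for w b
  proof -
    have "quot_coords R B w (\<lambda>b. \<Sum>s \<in> S. \<phi> s w * K (e s) b)"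
      unfolding coords[OF B(2) that]
    proof (intro conjI allI impI ballI)
      show "(\<Sum>s \<in> S. \<phi> s w * K (e s) b) = 0" if "b \<notin> B" for b
        using K e that by (auto simp: quot_coords_def intro!: sum.neutral)
      fix r assume r: "r \<in> S"
      have "(\<Sum>b \<in> B. (\<Sum>s \<in> S. \<phi> s w * K (e s) b) * \<phi> r b)
          = (\<Sum>s \<in> S. \<phi> s w * (\<Sum>b \<in> B. K (e s) b * \<phi> r b))"
        unfolding sum_distrib_left sum_distrib_right by (subst sum.swap) (simp add: mult.assoc)
      also have "\<dots> = (\<Sum>s \<in> S. if s = r then \<phi> s w else 0)"
        using r e by (intro sum.cong) (auto simp: dual simp flip: \<phi>_K)
      also have "\<dots> = \<phi> r w" using S r by simp
      finally show "\<phi> r w = (\<Sum>b \<in> B. (\<Sum>s \<in> S. \<phi> s w * K (e s) b) * \<phi> r b)" ..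
    qed
    with B(3)[OF that] K[OF that] have "K w = (\<lambda>b. \<Sum>s \<in> S. \<phi> s w * K (e s) b)" by blast
    then show ?thesis by (simp add: fun_eq_iff)
  qed
  have "quot_trace W R f = (\<Sum>b \<in> B. K (f b) b)"
    by (simp add: quot_trace_def Let_def B_def K_def)
  also have "\<dots> = (\<Sum>b \<in> B. \<Sum>r \<in> S. (\<Sum>s \<in> S. A r s * \<phi> s b) * K (e r) b)"
    using B(2) f A by (intro sum.cong refl, subst K_e) (auto intro!: sum.cong)
  also have "\<dots> = (\<Sum>r \<in> S. \<Sum>b \<in> B. \<Sum>s \<in> S. A r s * (K (e r) b * \<phi> s b))"
    unfolding sum_distrib_right by (subst sum.swap) (simp add: mult_ac)
  \<comment> \<open>The inner sum is the product of the two change-of-basis matrices. By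
    \<open>\<phi>_K\<close> it equals \<open>\<phi> s (e r)\<close>, which leaves only the diagonal
    of \<open>A\<close>.\<close>
  also have "\<dots> = (\<Sum>r \<in> S. \<Sum>s \<in> S. A r s * (\<Sum>b \<in> B. K (e r) b * \<phi> s b))"
    unfolding sum_distrib_left by (intro sum.cong refl, subst sum.swap) simp
  also have "\<dots> = (\<Sum>r \<in> S. \<Sum>s \<in> S. if s = r then A r s else 0)"
    using e by (intro sum.cong refl) (auto simp: dual simp flip: \<phi>_K)
  also have "\<dots> = (\<Sum>s \<in> S. A s s)" using S by simp
  finally show ?thesis .
qed

lemma cscale_zero [simp]: "cscale k 0 = 0" "cscale 0 f = 0" "cscale 1 f = f"
  by (simp_all add: cscale_def fun_eq_iff)

lemma sum_bvec_mult:
  assumes "finite A" "v \<in> A"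
  shows "(\<Sum>u \<in> A. bvec v u * k u) = k v"
proof -
  have "(\<Sum>u \<in> A. bvec v u * k u) = (\<Sum>u \<in> A. if u = v then k v else 0)"
    by (intro sum.cong) (auto simp: bvec_def)
  then show ?thesis using assms by simp
qed

lemma sum_cscale_bvec_mult:
  assumes "finite A" "v \<in> A"
  shows "(\<Sum>u \<in> A. cscale (bvec v u * k u) (g u)) = cscale (k v) (g v)"
proof -
  have "(\<Sum>u \<in> A. cscale (bvec v u * k u) (g u)) = (\<Sum>u \<in> A. if u = v then cscale (k v) (g v) else 0)"
    by (intro sum.cong) (auto simp: bvec_def)
  then show ?thesis using assms by simp
qed

section \<open>Representations of cyclic groups\<close>

text \<open>An eigenvector of \<open>\<rho> g\<close>, which exists over the complex numbers, is an
  eigenvector for every power of \<open>g\<close>. Its line is therefore invariant and, by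
  irreducibility, the whole space.\<close>

lemma irr_rep_dim_1_if_generated:
  assumes V: "(d, \<rho>) \<in> irr_reps G" and g: "g \<in> G"
    and gen: "\<And>h. h \<in> G \<Longrightarrow> \<exists>k. h = g ^^ k" and pow: "\<And>k. g ^^ k \<in> G"
  shows "d = 1"
proof -
  have rep: "is_rep G (d, \<rho>)" and d: "d > 0"
    and irr: "\<And>U. VectorSpace.subspace class_ring U (module_vec TYPE(complex) d) \<Longrightarrow>
        (\<forall>g \<in> G. \<forall>u \<in> U. \<rho> g *\<^sub>v u \<in> U) \<Longrightarrow> U = {0\<^sub>v d} \<or> U = carrier_vec d"
    using V by (auto simp: irr_reps_def)
  have carr: "\<And>h. h \<in> G \<Longrightarrow> \<rho> h \<in> carrier_mat d d" and one: "\<rho> id = 1\<^sub>m d"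
    and hom: "\<And>h k. h \<in> G \<Longrightarrow> k \<in> G \<Longrightarrow> \<rho> (h \<circ> k) = \<rho> h * \<rho> k"
    using rep by (auto simp: is_rep_def)
  obtain z where "eigenvalue (\<rho> g) z"
    using spectrum_non_empty[OF carr[OF g] d] by (auto simp: spectrum_def)
  then obtain v where v: "v \<in> carrier_vec d" "v \<noteq> 0\<^sub>v d" "\<rho> g *\<^sub>v v = z \<cdot>\<^sub>v v"
    using carr[OF g] by (auto simp: eigenvalue_def eigenvector_def)
  have ev: "\<rho> (g ^^ k) *\<^sub>v v = z ^ k \<cdot>\<^sub>v v" for k
  proof (induction k)
    case 0
    then show ?case using v(1) one by (simp add: id_def[symmetric])
  next
    case (Suc k)
    have "\<rho> (g ^^ Suc k) *\<^sub>v v = \<rho> g *\<^sub>v (\<rho> (g ^^ k) *\<^sub>v v)"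
      using hom[OF g pow[of k]] carr[OF g] carr[OF pow[of k]] v(1) by simp
    also have "\<dots> = z ^ k \<cdot>\<^sub>v (\<rho> g *\<^sub>v v)"
      unfolding Suc using carr[OF g] v(1) by (simp add: mult_mat_vec)
    also have "\<dots> = z ^ Suc k \<cdot>\<^sub>v v" using v by (simp add: smult_smult_assoc mult.commute)
    finally show ?case .
  qed
  interpret vec_space "TYPE(complex)" d .
  define U where "U = {c \<cdot>\<^sub>v v | c. True}"
  have sub: "VectorSpace.subspace class_ring U (module_vec TYPE(complex) d)"
  proof -
    have "submodule class_ring U (module_vec TYPE(complex) d)"
    proof (rule submodule.intro)
      show "Module.module class_ring (module_vec TYPE(complex) d)" by (rule module_axioms)
      show "U \<subseteq> carrier (module_vec TYPE(complex) d)" using v by (auto simp: U_def)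
      show "\<zero>\<^bsub>module_vec TYPE(complex) d\<^esub> \<in> U"
        using v by (auto simp: U_def module_vec_simps intro!: exI[of _ 0])
      show "x \<oplus>\<^bsub>module_vec TYPE(complex) d\<^esub> y \<in> U" if "x \<in> U" "y \<in> U" for x y
        using that unfolding U_def module_vec_simps by (auto simp: add_smult_distrib_vec[symmetric])
      show "c \<odot>\<^bsub>module_vec TYPE(complex) d\<^esub> x \<in> U" if "c \<in> carrier class_ring" "x \<in> U" for c x
        using that unfolding U_def module_vec_simps by (auto simp: smult_smult_assoc)
    qed
    then show ?thesis by (intro subspace.intro vec_vs)
  qed
  have "v \<in> U" unfolding U_def using v by (auto intro!: exI[of _ 1])
  moreover have "\<forall>h \<in> G. \<forall>u \<in> U. \<rho> h *\<^sub>v u \<in> U"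
  proof (intro ballI)
    fix h u assume "h \<in> G" "u \<in> U"
    obtain k where k: "h = g ^^ k" using gen[OF \<open>h \<in> G\<close>] by blast
    obtain c where c: "u = c \<cdot>\<^sub>v v" using \<open>u \<in> U\<close> by (auto simp: U_def)
    have "\<rho> h *\<^sub>v u = c \<cdot>\<^sub>v (z ^ k \<cdot>\<^sub>v v)"
      unfolding c k ev[symmetric] using carr[OF pow[of k]] v(1) by (simp add: mult_mat_vec)
    then show "\<rho> h *\<^sub>v u \<in> U" by (auto simp: U_def smult_smult_assoc)
  qed
  ultimately have U: "U = carrier_vec d" using irr[OF sub] v(2) by blast
  show ?thesis
  proof (rule ccontr)
    assume "d \<noteq> 1"
    then have d2: "d \<ge> 2" using d by simp
    \<comment> \<open>A line spanned by \<open>v\<close> cannot contain \<open>unit_vec d j\<close>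
      for \<open>j \<noteq> i\<close>: entry \<open>i\<close> forces the factor to be 0, entry
      \<open>j\<close> forces it to be nonzero.\<close>
    obtain i where i: "i < d" "v $ i \<noteq> 0"
      using v eq_vecI[of v "0\<^sub>v d"] by auto
    obtain j where j: "j < d" "j \<noteq> i"
      using d2 that[of "if i = 0 then 1 else 0"] by auto
    have "unit_vec d j \<in> U" "unit_vec d i \<in> U" unfolding U by auto
    then obtain c where c: "unit_vec d j = c \<cdot>\<^sub>v v" by (auto simp: U_def)
    have "c * v $ i = 0" "c * v $ j = 1"
      using arg_cong[OF c, of "\<lambda>w. w $ i"] arg_cong[OF c, of "\<lambda>w. w $ j"] i j v(1) by auto
    with i show False by auto
  qed
qed

lemma rep_dim_1_irr:
  assumes "is_rep G (1, \<rho>)"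
  shows "(1, \<rho>) \<in> irr_reps G"
  unfolding irr_reps_def
proof (clarify, intro conjI allI impI)
  interpret vec_space "TYPE(complex)" 1 .
  fix U assume sub: "VectorSpace.subspace class_ring U (module_vec TYPE(complex) 1)"
  then have sm: "submodule class_ring U (module_vec TYPE(complex) 1)" by (rule subspace.submod)
  have U: "U \<subseteq> carrier_vec 1" "0\<^sub>v 1 \<in> U"
    and smult: "\<And>c u. u \<in> U \<Longrightarrow> c \<cdot>\<^sub>v u \<in> U"
    using submodule.subset[OF sm] submodule.zero_closed[OF sm] submodule.smult_closed[OF sm]
    by (auto simp: module_vec_simps class_ring_simps)
  show "U = {0\<^sub>v 1} \<or> U = carrier_vec 1"
  proof (cases "U = {0\<^sub>v 1}")
    case False
    then obtain u where u: "u \<in> U" "u \<noteq> 0\<^sub>v 1" using U(2) by blast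
    have u1: "u \<in> carrier_vec 1" using u U by auto
    have "u $ 0 \<noteq> 0"
    proof
      assume "u $ 0 = 0"
      then have "u = 0\<^sub>v 1" using u1 by (intro eq_vecI) auto
      then show False using u by simp
    qed
    have "w \<in> U" if "w \<in> carrier_vec 1" for w
    proof -
      have "w = (w $ 0 / u $ 0) \<cdot>\<^sub>v u"
        using that u1 \<open>u $ 0 \<noteq> 0\<close> by (intro eq_vecI) auto
      then show ?thesis using smult[OF u(1)] by metis
    qed
    then show ?thesis using U by blast
  qed simp
qed (use assms in auto)

lemma index_mult_mat_1:
  fixes A B :: "'a :: comm_ring_1 mat"
  assumes "A \<in> carrier_mat 1 1" "B \<in> carrier_mat 1 1"
  shows "(A * B) $$ (0, 0) = A $$ (0, 0) * B $$ (0, 0)"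
  using assms by (simp add: scalar_prod_def)

lemma pure_dim_1: "v \<in> carrier_vec 1 \<Longrightarrow> pure c v = cscale (v $ 0) (bvec (c, 0))"
  by (auto simp: pure_def)

lemma pure_mult_mat_vec_1:
  "A \<in> carrier_mat 1 1 \<Longrightarrow> v \<in> carrier_vec 1 \<Longrightarrow>
    pure c (A *\<^sub>v v) = cscale (A $$ (0, 0) * v $ 0) (bvec (c, 0))"
  by (subst pure_dim_1) (auto simp: scalar_prod_def)

section \<open>The factorization and its orbits\<close>

locale symmetric_factorization =
  fixes n :: nat
  assumes n_pos: "0 < n"
begin

declare One_nat_def [simp del]

section \<open>Rotations, the powers of the shift\<close>

abbreviation rot :: "nat \<Rightarrow> perm" where
  "rot r \<equiv> shift n ^^ r"

lemma rot_outside: "i \<notin> {1..n} \<Longrightarrow> rot r i = i"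
  by (induction r) (auto simp: shift_def)

lemma rot_in: "i \<in> {1..n} \<Longrightarrow> rot r i \<in> {1..n}"
  using n_pos by (induction r) (auto simp: shift_def Suc_le_eq One_nat_def)

lemma rot_cong: "i \<in> {1..n} \<Longrightarrow> [rot r i = i + r] (mod n)"
proof (induction r)
  case (Suc r)
  have "rot (Suc r) i = rot r i mod n + 1" using rot_in[OF Suc.prems, of r] by (simp add: shift_def)
  then have "[rot (Suc r) i = rot r i + 1] (mod n)" by (simp add: cong_def mod_add_left_eq)
  also have "[rot r i + 1 = (i + r) + 1] (mod n)" using Suc by (intro cong_add) auto
  finally show ?case by (simp add: add.assoc One_nat_def)
qed auto

lemma rot_eqI:
  assumes "[r = s] (mod n)"
  shows "rot r = rot s"
proof
  fix i
  show "rot r i = rot s i"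
  proof (cases "i \<in> {1..n}")
    case True
    show ?thesis
    proof (rule cong_in_interval_imp_eq[of _ n])
      show "[rot r i = rot s i] (mod n)"
        using rot_cong[OF True] assms by (meson cong_add_lcancel_nat cong_sym cong_trans)
    qed (use rot_in[OF True] in auto)
  qed (use rot_outside in auto)
qed

text \<open>Because \<open>n\<close> plays the role of 0, the value at \<open>n\<close> recovers the
  exponent modulo \<open>n\<close>. A rotation is thus determined by where it sends
  \<open>n\<close>.\<close>

lemma rot_n_cong: "[rot r n = r] (mod n)"
  using rot_cong[of n r] n_pos by (auto simp: cong_def)

lemma rot_eq_iff: "rot r = rot s \<longleftrightarrow> [r = s] (mod n)"
  using rot_eqI rot_n_cong by (metis cong_sym cong_trans)

lemma rot_apply_n_eq_iff: "rot r n = rot s n \<longleftrightarrow> rot r = rot s"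
  using rot_eqI rot_n_cong by (metis cong_sym cong_trans)

lemma rot_self: "i \<in> {1..n} \<Longrightarrow> rot i n = i"
  using rot_n_cong rot_in n_pos by (intro cong_in_interval_imp_eq[of _ n]) auto

lemma rot_comp: "rot r \<circ> rot s = rot (r + s)"
  by (simp add: funpow_add)

lemma rot_comm: "rot r \<circ> rot s = rot s \<circ> rot r"
  by (simp add: rot_comp add.commute)

lemma rot_eq_id_iff: "rot r = id \<longleftrightarrow> n dvd r"
  using rot_eq_iff[of r 0] by (simp add: cong_0_iff id_def)

text \<open>Exponents are natural numbers, so \<open>(n - 1) * r\<close> stands in for the exponent
  \<open>-r\<close>.\<close>

lemma rot_neg: "rot r \<circ> rot ((n - 1) * r) = id" "rot ((n - 1) * r) \<circ> rot r = id"
proof -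
  have "r + (n - 1) * r = n * r" using n_pos by (cases n) auto
  then show "rot r \<circ> rot ((n - 1) * r) = id" "rot ((n - 1) * r) \<circ> rot r = id"
    using rot_eq_id_iff[of "n * r"] by (auto simp: rot_comp add.commute)
qed

lemma rot_permutes: "rot r permutes {1..n}"
proof (rule bij_imp_permutes)
  show "bij_betw (rot r) {1..n} {1..n}"
    using rot_neg[of r] rot_in
    by (intro bij_betw_byWitness[where f' = "rot ((n - 1) * r)"]) (auto simp: fun_eq_iff)
qed (use rot_outside in auto)

lemma sym_group_pow: "x [^]\<^bsub>sym_group n\<^esub> (k :: nat) = x ^^ k"
  by (induction k) (auto simp: nat_pow_def sym_group_def fun_eq_iff funpow_swap1)

text \<open>In a finite group the inverse of an element is among its natural powers, so the
  generated subgroup consists of these powers alone.\<close>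

lemma generate_rot: "generate (sym_group n) {rot t} = {rot (t * k) | k. True}"
proof -
  interpret group "sym_group n" by (rule sym_group_is_group)
  have "finite (carrier (sym_group n))" by (simp add: sym_group_def finite_permutations)
  then have "generate (sym_group n) {rot t} = {rot t [^]\<^bsub>sym_group n\<^esub> k | k. k \<in> (UNIV :: nat set)}"
    using rot_permutes by (intro generate_pow_on_finite_carrier) (auto simp: sym_group_def)
  then show ?thesis by (simp add: sym_group_pow funpow_mult)
qed

lemma Cyc_eq: "Cyc n = range rot"
  using generate_rot[of 1] by (auto simp: Cyc_def One_nat_def)

lemma Cyc_eq_image: "Cyc n = rot ` {..<n}"
proof -
  have "rot r = rot (r mod n)" for r by (simp add: rot_eq_iff)
  then show ?thesis using n_pos unfolding Cyc_eq by (metis (no_types, lifting) image_eqI mod_less_divisor lessThan_iff subset_antisym image_subsetI UNIV_I)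
qed

lemma inj_on_rot: "inj_on rot {..<n}"
  by (auto simp: inj_on_def rot_eq_iff cong_def)

lemma finite_Cyc: "finite (Cyc n)"
  by (simp add: Cyc_eq_image)

lemma card_Cyc: "card (Cyc n) = n"
  unfolding Cyc_eq_image by (simp add: card_image[OF inj_on_rot])

lemma rot_in_Cyc: "rot r \<in> Cyc n"
  by (auto simp: Cyc_eq)

lemma Cyc_comp: "b \<in> Cyc n \<Longrightarrow> c \<in> Cyc n \<Longrightarrow> b \<circ> c \<in> Cyc n"
  by (auto simp: Cyc_eq rot_comp)

lemma Cyc_comm: "b \<in> Cyc n \<Longrightarrow> c \<in> Cyc n \<Longrightarrow> b \<circ> c = c \<circ> b"
  by (auto simp: Cyc_eq rot_comm)

lemma Cyc_permutes: "c \<in> Cyc n \<Longrightarrow> c permutes {1..n}"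
  using rot_permutes by (auto simp: Cyc_eq)

lemma Cyc_inv: "c \<in> Cyc n \<Longrightarrow> inv' c \<in> Cyc n"
  unfolding Cyc_eq using inv_unique_comp[OF rot_neg] by auto

lemma Cyc_eqI: "b \<in> Cyc n \<Longrightarrow> c \<in> Cyc n \<Longrightarrow> b n = c n \<Longrightarrow> b = c"
  by (auto simp: Cyc_eq rot_apply_n_eq_iff)

section \<open>The unique factorization into a rotation and a permutation fixing
  \<open>n\<close>\<close>

lemma Stb_iff: "x \<in> Stb n \<longleftrightarrow> x permutes {1..n} \<and> x n = n"
  by (auto simp: Stb_def sym_group_def)

lemma finite_Stb: "finite (Stb n)"
  by (rule finite_subset[OF _ finite_permutations[of "{1..n}"]]) (auto simp: Stb_iff)

lemma id_in_Stb: "id \<in> Stb n" and id_in_Cyc: "id \<in> Cyc n"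
  using rot_in_Cyc[of 0] by (auto simp: Stb_iff permutes_id simp flip: id_def)

lemma Stb_inv: "x \<in> Stb n \<Longrightarrow> inv' x \<in> Stb n"
  using permutes_inv by (metis Stb_iff permutes_inverses(2))

lemma Stb_comp_inv: assumes "x \<in> Stb n" shows "x \<circ> inv' x = id" "inv' x \<circ> x = id"
  using assms by (auto simp: Stb_iff permutes_inv_o)

lemma Cyc_comp_inv: assumes "x \<in> Cyc n" shows "x \<circ> inv' x = id" "inv' x \<circ> x = id"
  using permutes_inv_o[OF Cyc_permutes[OF assms]] by auto

text \<open>Evaluation at \<open>n\<close>, which \<open>y\<close> and \<open>y'\<close> fix, gives
  \<open>c n = c' n\<close>. This determines the rotation, and the other factor follows by
  cancellation.\<close>

lemma factorization_unique:
  assumes "c \<in> Cyc n" "c' \<in> Cyc n" "y \<in> Stb n" "y' \<in> Stb n" "c \<circ> y = c' \<circ> y'"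
  shows "c = c'" "y = y'"
proof -
  show c: "c = c'"
    using assms by (intro Cyc_eqI) (auto simp: Stb_iff fun_eq_iff, metis)
  have "inv' c \<circ> (c \<circ> y) = inv' c \<circ> (c \<circ> y')" using assms c by simp
  then show "y = y'" using Cyc_comp_inv[OF assms(1)] by (simp add: o_assoc)
qed

text \<open>The rotation sending \<open>n\<close> to \<open>p n\<close> is split off; what remains
  fixes \<open>n\<close>.\<close>

lemma factorization_exists:
  assumes "p permutes {1..n}"
  shows "\<exists>c \<in> Cyc n. \<exists>y \<in> Stb n. p = c \<circ> y"
proof -
  have pn: "p n \<in> {1..n}" using permutes_in_image[OF assms, of n] n_pos by (simp add: Suc_le_eq One_nat_def)
  define c where "c = rot (p n)"
  have c: "c \<in> Cyc n" by (simp add: c_def rot_in_Cyc)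
  have "c n = p n" using rot_self[OF pn] by (simp add: c_def)
  then have "inv' c \<circ> p \<in> Stb n"
    using assms Cyc_permutes[OF c] by (auto simp: Stb_iff permutes_compose permutes_inv permutes_inv_eq)
  moreover have "p = c \<circ> (inv' c \<circ> p)" using Cyc_comp_inv[OF c] by (simp add: o_assoc)
  ultimately show ?thesis using c by blast
qed

section \<open>The two actions\<close>

text \<open>Exhibiting any factorization of \<open>x \<circ> b\<close> computes both actions, since
  uniqueness settles the two \<open>THE\<close> descriptions at once.\<close>

lemma act_eqI:
  assumes "c \<in> Cyc n" "y \<in> Stb n" "x \<circ> b = c \<circ> y"
  shows "lact n x b = c" "ract n x b = y"
  unfolding lact_def ract_def using assms factorization_unique[OF assms(1) _ assms(2)]
  by (auto intro!: the_equality)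

lemma act:
  assumes "x \<in> Stb n" "b \<in> Cyc n"
  shows "x \<circ> b = lact n x b \<circ> ract n x b" "lact n x b \<in> Cyc n" "ract n x b \<in> Stb n"
proof -
  have "x \<circ> b permutes {1..n}" using assms Cyc_permutes by (auto simp: Stb_iff permutes_compose)
  then obtain c y where "c \<in> Cyc n" "y \<in> Stb n" "x \<circ> b = c \<circ> y"
    using factorization_exists by blast
  with act_eqI[OF this] show "x \<circ> b = lact n x b \<circ> ract n x b" "lact n x b \<in> Cyc n" "ract n x b \<in> Stb n"
    by auto
qed

text \<open>Factoring \<open>x \<circ> b\<close> first and then moving \<open>c\<close> across the
  remaining factor gives a factorization of \<open>x \<circ> (b \<circ> c)\<close>. The first
  identity is the action law, the second a cocycle rule for \<open>lact\<close>.\<close>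

lemma act_comp:
  assumes "x \<in> Stb n" "b \<in> Cyc n" "c \<in> Cyc n"
  shows "ract n x (b \<circ> c) = ract n (ract n x b) c"
    "lact n x (b \<circ> c) = lact n x b \<circ> lact n (ract n x b) c"
proof -
  note * = act[OF assms(1,2)] act[OF act(3)[OF assms(1,2)] assms(3)]
  have eq: "x \<circ> (b \<circ> c) = (lact n x b \<circ> lact n (ract n x b) c) \<circ> ract n (ract n x b) c"
    by (metis * o_assoc)
  show "ract n x (b \<circ> c) = ract n (ract n x b) c"
    "lact n x (b \<circ> c) = lact n x b \<circ> lact n (ract n x b) c"
    using act_eqI[OF _ _ eq] * by (auto intro: Cyc_comp)
qed

lemma ract_id: "x \<in> Stb n \<Longrightarrow> ract n x id = x"
  by (rule act_eqI(2)[OF id_in_Cyc]) auto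

lemma ract_of_id: "b \<in> Cyc n \<Longrightarrow> ract n id b = id"
  by (rule act_eqI(2)[OF _ id_in_Stb]) auto

lemma ract_cancel:
  assumes "y \<in> Stb n" "x \<in> Stb n" "b \<in> Cyc n"
  shows "ract n y b = x \<longleftrightarrow> y = ract n x (inv' b)"
proof
  assume "ract n y b = x"
  then show "y = ract n x (inv' b)"
    using act_comp(1)[OF assms(1,3) Cyc_inv[OF assms(3)]] assms Cyc_comp_inv ract_id by auto
next
  assume "y = ract n x (inv' b)"
  then show "ract n y b = x"
    using act_comp(1)[OF assms(2) Cyc_inv[OF assms(3)] assms(3)] assms Cyc_comp_inv ract_id by auto
qed

lemma ract_rot_add:
  "x \<in> Stb n \<Longrightarrow> ract n x (rot (r + s)) = ract n (ract n x (rot r)) (rot s)"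
  by (simp add: act_comp rot_in_Cyc flip: rot_comp)

text \<open>The period \<open>p\<close> is the least positive return time. Division with remainder
  shows that every return time is a multiple of it, and \<open>n\<close> is one because
  \<open>rot n = id\<close>.\<close>

lemma ex_period:
  assumes x: "x \<in> Stb n"
  obtains p where "0 < p" "p dvd n" "\<And>r. ract n x (rot r) = x \<longleftrightarrow> p dvd r"
proof -
  define p where "p = (LEAST r. 0 < r \<and> ract n x (rot r) = x)"
  have "rot n = id" using rot_eq_id_iff by simp
  then have n: "ract n x (rot n) = x" using x ract_id by simp
  have p: "0 < p \<and> ract n x (rot p) = x"
    unfolding p_def by (rule LeastI[of _ n]) (use n n_pos in auto)
  have mult: "ract n x (rot (p * k)) = x" for k
  proof (induction k)
    case 0
    then show ?case using ract_id[OF x] by (simp add: id_def)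
  next
    case (Suc k)
    then show ?case using p ract_rot_add[OF x, of "p * k" p] by (simp add: add.commute)
  qed
  have iff: "ract n x (rot r) = x \<longleftrightarrow> p dvd r" for r
  proof
    assume r: "ract n x (rot r) = x"
    have "ract n x (rot (r mod p)) = x"
      using r ract_rot_add[OF x, of "p * (r div p)" "r mod p"] mult by simp
    then have "\<not> 0 < r mod p"
      using p not_less_Least[of "r mod p" "\<lambda>r. 0 < r \<and> ract n x (rot r) = x"] unfolding p_def[symmetric]
      by auto
    then show "p dvd r" by auto
  qed (use mult in auto)
  from that[of p] p n iff show thesis by simp
qed

section \<open>Orbits and their lengths\<close>

lemma orb_eq: "orb n x = range (\<lambda>r. ract n x (rot r))"
  by (auto simp: orb_def Cyc_eq)

lemma self_in_orb: "x \<in> Stb n \<Longrightarrow> x \<in> orb n x"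
  using id_in_Cyc ract_id by (force simp: orb_def)

lemma orb_subset_Stb: "x \<in> Stb n \<Longrightarrow> orb n x \<subseteq> Stb n"
  using act(3) by (auto simp: orb_def)

lemma finite_orb: "finite (orb n x)"
  by (simp add: orb_def finite_Cyc)

lemma orb_eq_if_mem:
  assumes x: "x \<in> Stb n" and "y \<in> orb n x"
  shows "orb n y = orb n x"
proof -
  obtain b where b: "b \<in> Cyc n" "y = ract n x b" using assms by (auto simp: orb_def)
  have y: "y \<in> Stb n" using act(3)[OF x b(1)] b by simp
  have "ract n y c = ract n x (b \<circ> c)" "ract n x c = ract n y (inv' b \<circ> c)" if "c \<in> Cyc n" for c
    using b x y that act_comp(1)[OF x b(1) that] act_comp(1)[OF y Cyc_inv[OF b(1)] that]
      ract_cancel[OF x y b(1)] by auto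
  then show ?thesis
    unfolding orb_def using b(1) Cyc_comp Cyc_inv by (intro equalityI image_subsetI) simp_all
qed

text \<open>An explicit orbit-stabilizer theorem: the exponents below the period list the orbit
  without repetition.\<close>

lemma card_orb_period:
  assumes x: "x \<in> Stb n" and p: "0 < p" "p dvd n" "\<And>r. ract n x (rot r) = x \<longleftrightarrow> p dvd r"
  shows "card (orb n x) = p"
proof -
  have "orb n x = (\<lambda>r. ract n x (rot r)) ` {..<p}"
  proof -
    have "ract n x (rot r) = ract n x (rot (r mod p))" for r
    proof -
      have "ract n x (rot (p * (r div p))) = x" using p(3) by simp
      then show ?thesis using ract_rot_add[OF x, of "p * (r div p)" "r mod p"] by simp
    qed
    then show ?thesis unfolding orb_eq using p(1)
      by (auto simp: image_iff) (metis mod_less_divisor lessThan_iff)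
  qed
  moreover have "inj_on (\<lambda>r. ract n x (rot r)) {..<p}"
  proof (rule inj_onI)
    fix r s assume rs: "r \<in> {..<p}" "s \<in> {..<p}" "ract n x (rot r) = ract n x (rot s)"
    \<comment> \<open>Applying the inverse of \<open>rot s\<close> to both sides turns the equality
      into a return time, congruent to \<open>r - s\<close> modulo \<open>n\<close>.\<close>
    have "p dvd r + (n - 1) * s"
      using rs(3) ract_rot_add[OF x, of _ "(n - 1) * s"] rot_neg(1)[of s] ract_id[OF x]
      unfolding p(3)[symmetric] rot_comp by metis
    moreover have "r + (n - 1) * s + s = r + n * s" using n_pos by (cases n) auto
    ultimately have "[r + n * s = s] (mod p)"
      by (metis cong_0_iff cong_add_rcancel_0_nat)
    moreover have "[n * s = 0] (mod p)" using p(2) by (simp add: cong_0_iff)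
    ultimately have "[r = s] (mod p)"
      by (metis add.right_neutral cong_add_lcancel_nat cong_sym cong_trans)
    then show "r = s" using rs by (simp add: cong_def)
  qed
  ultimately show ?thesis by (simp add: card_image)
qed

section \<open>Stabilizers and the sets \<open>M n t\<close>\<close>

lemma stab_iff: "rot r \<in> stab n x \<longleftrightarrow> ract n x (rot r) = x"
  by (auto simp: stab_def rot_in_Cyc)

text \<open>The exponent of a rotation is known only modulo \<open>n\<close>; for
  \<open>t dvd n\<close> its divisibility by \<open>t\<close> is nevertheless well defined.\<close>

lemma rot_in_multiples_iff:
  assumes "t dvd n"
  shows "rot r \<in> {rot (t * k) | k. True} \<longleftrightarrow> t dvd r"
proof
  assume "rot r \<in> {rot (t * k) | k. True}"
  then obtain k where "[r = t * k] (mod n)" by (auto simp: rot_eq_iff)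
  then have "[r = t * k] (mod t)" using assms by (rule cong_dvd_modulus_nat)
  then show "t dvd r" by (simp add: cong_dvd_iff)
qed auto

lemma M_iff:
  assumes t: "t dvd n"
  shows "x \<in> M n t \<longleftrightarrow> x \<in> Stb n \<and> (\<forall>r. ract n x (rot r) = x \<longleftrightarrow> t dvd r)"
proof -
  \<comment> \<open>Both sets consist of rotations, so their equality can be tested on the elements
    \<open>rot r\<close>.\<close>
  have "stab n x = {rot (t * k) | k. True} \<longleftrightarrow> (\<forall>r. rot r \<in> stab n x \<longleftrightarrow> rot r \<in> {rot (t * k) | k. True})"
  proof
    assume "stab n x = {rot (t * k) | k. True}"
    then show "\<forall>r. rot r \<in> stab n x \<longleftrightarrow> rot r \<in> {rot (t * k) | k. True}" by (simp only: simp_thms)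
  next
    assume *: "\<forall>r. rot r \<in> stab n x \<longleftrightarrow> rot r \<in> {rot (t * k) | k. True}"
    show "stab n x = {rot (t * k) | k. True}"
    proof (intro equalityI subsetI)
      fix g assume g: "g \<in> stab n x"
      then obtain r where "g = rot r" by (auto simp: stab_def Cyc_eq)
      with * g show "g \<in> {rot (t * k) | k. True}" by blast
    next
      fix g assume g: "g \<in> {rot (t * k) | k. True}"
      with * show "g \<in> stab n x" by blast
    qed
  qed
  then show ?thesis unfolding M_def generate_rot mem_Collect_eq[of x]
    by (simp only: stab_iff rot_in_multiples_iff[OF t])
qed

text \<open>The period is the only number whose multiples are exactly the return times, and it
  equals the orbit length. Hence \<open>M n t\<close> is a union of whole orbits.\<close>

lemma M_iff_card_orb:
  assumes t: "t dvd n"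
  shows "x \<in> M n t \<longleftrightarrow> x \<in> Stb n \<and> card (orb n x) = t"
proof (cases "x \<in> Stb n")
  case x: True
  obtain p where p: "0 < p" "p dvd n" "\<And>r. ract n x (rot r) = x \<longleftrightarrow> p dvd r"
    using ex_period[OF x] by blast
  have "(\<forall>r. ract n x (rot r) = x \<longleftrightarrow> t dvd r) \<longleftrightarrow> p = t"
    using p(3) by (metis dvd_antisym dvd_refl)
  then show ?thesis using M_iff[OF t] card_orb_period[OF x p] x by simp
qed (use M_iff[OF t] in auto)

lemma M_subset_Stb: "M n t \<subseteq> Stb n"
  by (auto simp: M_def)

lemma stab_M:
  assumes "x \<in> M n t"
  shows "stab n x = {rot (t * k) | k. True}"
  using assms generate_rot by (simp add: M_def)

lemma M_orb:
  assumes "t dvd n" "x \<in> M n t" "y \<in> orb n x"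
  shows "y \<in> M n t"
  using assms M_iff_card_orb[OF assms(1)] orb_subset_Stb orb_eq_if_mem by (metis subsetD)

section \<open>Inversion and involutions\<close>

text \<open>From \<open>x b = k w\<close> one gets
  \<open>x\<^sup>-\<^sup>1 k = b w\<^sup>-\<^sup>1\<close>, again a factorization of the required
  kind. Inversion therefore carries the orbit of \<open>x\<close> into that of
  \<open>inv' x\<close>, with the rotations \<open>b\<close> and \<open>k\<close> exchanged.\<close>

lemma ract_inverse:
  assumes "x \<in> Stb n" "b \<in> Cyc n"
  shows "ract n (inv' x) (lact n x b) = inv' (ract n x b)"
    "lact n (inv' x) (lact n x b) = b"
proof -
  let ?k = "lact n x b" and ?w = "ract n x b"
  have w: "?w \<in> Stb n" by (rule act(3)[OF assms])
  have eq: "x \<circ> b = ?k \<circ> ?w" by (rule act(1)[OF assms])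
  have "inv' x \<circ> ?k = inv' x \<circ> (?k \<circ> ?w) \<circ> inv' ?w"
    using Stb_comp_inv(1)[OF w] by (simp add: o_assoc[symmetric])
  also have "\<dots> = b \<circ> inv' ?w"
    unfolding eq[symmetric] using Stb_comp_inv(2)[OF assms(1)] by (simp add: o_assoc)
  finally have eq': "inv' x \<circ> ?k = b \<circ> inv' ?w" .
  show "ract n (inv' x) ?k = inv' ?w" "lact n (inv' x) ?k = b"
    using act_eqI[OF assms(2) Stb_inv[OF w] eq'] by auto
qed

lemma Stb_inv_inv: "x \<in> Stb n \<Longrightarrow> inv' (inv' x) = x"
  by (auto simp: Stb_iff permutes_inv_inv)

text \<open>Once one inverse lies in the orbit, inversion maps the whole orbit to itself. An odd
  length then forces a fixed point, which is an involution.\<close>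

lemma involution_if_inv_mem_odd_orb:
  assumes y: "y \<in> Stb n" "inv' y \<in> orb n y" and odd: "odd (card (orb n y))"
  shows "orb n y \<inter> involutions n \<noteq> {}"
proof -
  have inv_closed: "inv' z \<in> orb n y" if z: "z \<in> orb n y" for z
  proof -
    obtain b where b: "b \<in> Cyc n" "z = ract n y b" using z by (auto simp: orb_def)
    then have "inv' z = ract n (inv' y) (lact n y b)" using ract_inverse y by simp
    then have "inv' z \<in> orb n (inv' y)" using act(2)[OF y(1) b(1)] by (auto simp: orb_def)
    then show ?thesis using orb_eq_if_mem[OF y] by simp
  qed
  have "\<exists>z \<in> orb n y. inv' z = z"
  proof (rule ccontr)
    assume "\<not> ?thesis"
    then have "even (card (orb n y))"
      using inv_closed Stb_inv_inv orb_subset_Stb[OF y(1)] finite_orb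
      by (intro even_card_if_fixpoint_free_involution[where f = inv']) auto
    with odd show False by simp
  qed
  then obtain z where z: "z \<in> orb n y" "inv' z = z" by blast
  then have "z \<in> Stb n" using orb_subset_Stb[OF y(1)] by blast
  then have "z \<in> involutions n" using z Stb_comp_inv(1)[of z] by (simp add: involutions_def)
  with z show ?thesis by blast
qed

text \<open>
  If \<open>x\<close> is an involution and \<open>y = k\<^sup>-\<^sup>1 x e\<close> lies in its orbit, then \<open>b = k\<^sup>-\<^sup>1 e\<close> solves
  \<open>ract n (inv' y) b = y\<close>, with \<open>lact n (inv' y) b = b\<^sup>-\<^sup>1\<close>; the other solutions are \<open>b f\<close>
  with \<open>f\<close> in the stabilizer.
\<close>

lemma ex_rotation_to_inverse:
  assumes x: "x \<in> Stb n" "x \<circ> x = id" and y: "y \<in> orb n x"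
  obtains b where "b \<in> Cyc n" "ract n (inv' y) b = y" "lact n (inv' y) b = inv' b"
proof -
  obtain e where e: "e \<in> Cyc n" "y = ract n x e" using y by (auto simp: orb_def)
  define k where "k = lact n x e"
  have k: "k \<in> Cyc n" "x \<circ> e = k \<circ> y" using act[OF x(1) e(1)] e(2) by (auto simp: k_def)
  have yS: "y \<in> Stb n" using act(3)[OF x(1) e(1)] e by simp
  have xi: "inv' x = x" using x(2) by (simp add: inv_unique_comp)
  have y1: "ract n x k = inv' y" "lact n x k = e"
    using ract_inverse[OF x(1) e(1)] by (simp_all add: xi k_def e(2))
  define b where "b = inv' k \<circ> e"
  have b: "b \<in> Cyc n" using Cyc_comp Cyc_inv k(1) e(1) by (simp add: b_def)
  have kb: "k \<circ> b = e" using Cyc_comp_inv(1)[OF k(1)] by (simp add: b_def o_assoc)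
  have "ract n (inv' y) b = ract n x (k \<circ> b)" using act_comp(1)[OF x(1) k(1) b] y1 by simp
  then have 1: "ract n (inv' y) b = y" using kb e by simp
  \<comment> \<open>Computing \<open>lact n x e\<close> through \<open>e = k \<circ> b\<close> with
    the cocycle rule expresses \<open>k\<close> as \<open>e\<close> times the unknown rotation,
    which is thereby the inverse of \<open>b\<close>.\<close>
  have "k = lact n x (k \<circ> b)" unfolding kb by (simp add: k_def)
  also have "\<dots> = e \<circ> lact n (inv' y) b" using act_comp(2)[OF x(1) k(1) b] y1 by simp
  finally have ke: "k = e \<circ> lact n (inv' y) b" .
  have l: "lact n (inv' y) b \<in> Cyc n" using act(2)[OF Stb_inv[OF yS] b] .
  have "k \<circ> (b \<circ> lact n (inv' y) b) = k \<circ> id"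
    using ke kb by (metis comp_id o_assoc)
  then have "inv' k \<circ> (k \<circ> (b \<circ> lact n (inv' y) b)) = inv' k \<circ> (k \<circ> id)" by simp
  then have "b \<circ> lact n (inv' y) b = id"
    using Cyc_comp_inv(2)[OF k(1)] by (simp add: o_assoc)
  then have "lact n (inv' y) b = inv' b"
    using Cyc_comm[OF b l] by (intro inv_unique_comp[symmetric]) auto
  with that b 1 show thesis by blast
qed

text \<open>Expanding \<open>lact n x\<close> at \<open>e \<circ> f = f \<circ> e\<close> in both
  orders and cancelling \<open>lact n x e\<close> in the commutative group \<open>Cyc n\<close>
  gives the claim. So the action on the stabilizer may be computed at any point of the
  orbit.\<close>

lemma lact_stab_eq_if_mem_orb:
  assumes x: "x \<in> Stb n" and y: "y \<in> orb n x" and f: "f \<in> stab n x"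
  shows "lact n y f = lact n x f"
proof -
  obtain e where e: "e \<in> Cyc n" "y = ract n x e" using y by (auto simp: orb_def)
  have fC: "f \<in> Cyc n" "ract n x f = x" using f by (auto simp: stab_def)
  have "lact n x e \<circ> lact n y f = lact n x (e \<circ> f)" using act_comp(2)[OF x e(1) fC(1)] e by simp
  also have "\<dots> = lact n x (f \<circ> e)" using Cyc_comm[OF e(1) fC(1)] by simp
  also have "\<dots> = lact n x f \<circ> lact n x e" using act_comp(2)[OF x fC(1) e(1)] fC by simp
  also have "\<dots> = lact n x e \<circ> lact n x f" using Cyc_comm act(2) x fC(1) e(1) by simp
  finally have "inv' (lact n x e) \<circ> (lact n x e \<circ> lact n y f) = inv' (lact n x e) \<circ> (lact n x e \<circ> lact n x f)"
    by simp
  then show ?thesis using Cyc_comp_inv(2)[OF act(2)[OF x e(1)]] by (simp add: o_assoc)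
qed

lemma stab_eq_if_mem_orb:
  assumes "t dvd n" "x \<in> M n t" "y \<in> orb n x"
  shows "stab n y = stab n x"
  using stab_M M_orb assms by metis

text \<open>As \<open>x\<close> is its own inverse, \<open>ract_inverse\<close> shows that
  \<open>lact n x\<close> maps \<open>rot t\<close> to some \<open>c\<close> in the stabilizer and
  \<open>c\<close> back to \<open>rot t\<close>. On the cyclic stabilizer \<open>lact n x\<close>
  multiplies exponents by some \<open>j\<close>, and returning to \<open>rot t\<close> means that
  \<open>j\<close> squares to 1.\<close>

lemma ex_multiplier:
  assumes t: "t dvd n" and x: "x \<in> M n t" "x \<circ> x = id"
  obtains j where "j \<in> E (n div t)" "\<And>k. lact n x (rot (t * k)) = rot (t * (j * k))"
    "\<And>y. y \<in> orb n x \<Longrightarrow> [y t = j * t] (mod n)"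
proof -
  define m where "m = n div t"
  have n: "n = t * m" using t by (simp add: m_def)
  have tm: "0 < t" "0 < m" using n n_pos by auto
  have xS: "x \<in> Stb n" using x M_subset_Stb by blast
  have fix_iff: "ract n x (rot r) = x \<longleftrightarrow> t dvd r" for r using x(1) M_iff[OF t] by simp
  have xi: "inv' x = x" using x(2) by (simp add: inv_unique_comp)
  define c where "c = lact n x (rot t)"
  have c: "c \<in> Cyc n" unfolding c_def by (rule act(2)[OF xS rot_in_Cyc])
  have "ract n x c = x" "lact n x c = rot t"
    using ract_inverse[OF xS rot_in_Cyc[of t]] fix_iff[of t] by (auto simp: xi c_def)
  then have "c \<in> stab n x" using c by (simp add: stab_def)
  then obtain j0 where j0: "c = rot (t * j0)" using stab_M[OF x(1)] by auto
  \<comment> \<open>Only the class of \<open>j0\<close> modulo \<open>m\<close> matters; it is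
    normalized to the range used in \<open>E\<close>.\<close>
  obtain j where j: "j \<in> {1..m}" "[j0 = j] (mod m)" using ex_cong_in_interval[OF tm(2)] by blast
  have cj: "c = rot (t * j)"
  proof -
    have "[t * j0 = t * j] (mod n)" using j(2) by (simp add: n cong_def flip: mult_mod_right)
    then show ?thesis unfolding j0 rot_eq_iff .
  qed
  have l: "lact n x (rot (t * k)) = rot (t * (j * k))" for k
  proof (induction k)
    case 0
    have "lact n x id = id" by (rule act_eqI(1)[OF id_in_Cyc xS]) simp
    then show ?case by (simp add: id_def)
  next
    case (Suc k)
    have "lact n x (rot (t * Suc k)) = lact n x (rot (t * k)) \<circ> lact n (ract n x (rot (t * k))) (rot t)"
      using act_comp(2)[OF xS rot_in_Cyc rot_in_Cyc, of "t * k" t] by (simp add: rot_comp add.commute)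
    also have "\<dots> = rot (t * (j * k)) \<circ> rot (t * j)"
      using fix_iff[of "t * k"] Suc cj by (simp add: c_def)
    finally show ?case by (simp add: rot_comp algebra_simps)
  qed
  have "rot (t * (j * j)) = rot (t * 1)"
    using \<open>lact n x c = rot t\<close> l[of j] cj by simp
  then have "[t * (j * j) = t * 1] (mod (t * m))" unfolding rot_eq_iff by (simp only: n)
  then have "[j * j = 1] (mod m)" using tm by (simp add: cong_def mult_mod_right[symmetric])
  then have "j \<in> E m" using j by (simp add: E_def power2_eq_square)
  moreover have "[y t = j * t] (mod n)" if y: "y \<in> orb n x" for y
  proof -
    have yS: "y \<in> Stb n" using y orb_subset_Stb[OF xS] by blast
    have f: "rot t \<in> stab n x" using fix_iff stab_iff by simp
    then have "rot t \<in> stab n y" using stab_eq_if_mem_orb[OF t x(1) y] by simp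
    \<comment> \<open>Evaluating this commutation relation at \<open>n\<close> reads the multiplier
      off as the value of \<open>y\<close> at \<open>t\<close>.\<close>
    then have "y \<circ> rot t = lact n y (rot t) \<circ> y"
      using act(1)[OF yS rot_in_Cyc[of t]] by (simp add: stab_def)
    then have "y (rot t n) = rot (t * j) (y n)"
      using lact_stab_eq_if_mem_orb[OF xS y f] by (simp add: c_def[symmetric] cj fun_eq_iff)
    moreover have "rot t n = t" using t tm n_pos by (intro rot_self) (auto dest: dvd_imp_le simp: Suc_leI One_nat_def)
    moreover have "y n = n" using yS by (simp add: Stb_iff)
    ultimately show ?thesis using rot_n_cong[of "t * j"] by (simp add: mult.commute)
  qed
  ultimately show thesis using that[of j] l by (simp add: m_def)
qed

section \<open>The integral of the Hopf algebra\<close>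

lemma finite_JB: "finite (JB n)"
  by (simp add: JB_def finite_Stb finite_Cyc)

lemma J_mult_alt:
  "J_mult n f g = (\<Sum>u \<in> JB n. \<Sum>v \<in> JB n. cscale (f u * g v)
     (if fst v = ract n (fst u) (snd u) then bvec (fst u, snd u \<circ> snd v) else 0))"
  by (simp add: J_mult_def split_def)

lemma J_mult_bvec:
  assumes "y \<in> Stb n" "b \<in> Cyc n" "z \<in> Stb n" "c \<in> Cyc n"
  shows "J_mult n (bvec (y, b)) (bvec (z, c)) = (if z = ract n y b then bvec (y, b \<circ> c) else 0)"
proof -
  have mem: "(y, b) \<in> JB n" "(z, c) \<in> JB n" using assms by (auto simp: JB_def)
  have "J_mult n (bvec (y, b)) (bvec (z, c)) = (\<Sum>u \<in> JB n. \<Sum>v \<in> JB n. cscale (bvec (z, c) v * bvec (y, b) u)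
     (if fst v = ract n (fst u) (snd u) then bvec (fst u, snd u \<circ> snd v) else 0))"
    by (simp add: J_mult_alt mult.commute)
  also have "\<dots> = (\<Sum>u \<in> JB n. cscale (bvec (y, b) u * 1)
     (if z = ract n (fst u) (snd u) then bvec (fst u, snd u \<circ> c) else 0))"
    unfolding sum_cscale_bvec_mult[OF finite_JB mem(2)] fst_conv snd_conv by simp
  also have "\<dots> = (if z = ract n y b then bvec (y, b \<circ> c) else 0)"
    unfolding sum_cscale_bvec_mult[OF finite_JB mem(1)] fst_conv snd_conv by simp
  finally show ?thesis .
qed

text \<open>The candidate for the integral: the average of the elements of \<open>Cyc n\<close>,
  placed at the identity permutation.\<close>

definition haar :: jvec where
  "haar = (\<lambda>(y, b). if y = id \<and> b \<in> Cyc n then 1 / of_nat n else 0)"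

lemma sum_JB: "(\<Sum>u \<in> JB n. g u) = (\<Sum>b \<in> Cyc n. \<Sum>y \<in> Stb n. g (y, b))"
  unfolding JB_def by (subst sum.swap) (simp add: sum.cartesian_product split_def)

lemma sum_haar:
  "(\<Sum>v \<in> JB n. cscale (haar v * k v) (g v)) = (\<Sum>c \<in> Cyc n. cscale (k (id, c) / of_nat n) (g (id, c)))"
proof -
  have "(\<Sum>v \<in> JB n. cscale (haar v * k v) (g v)) = (\<Sum>c \<in> Cyc n. \<Sum>z \<in> Stb n.
      if z = id then cscale (k (id, c) / of_nat n) (g (id, c)) else 0)"
    unfolding sum_JB by (intro sum.cong) (auto simp: haar_def)
  then show ?thesis using finite_Stb id_in_Stb by simp
qed

lemma haar_in_J: "haar \<in> J n"
  by (auto simp: haar_def J_def JB_def id_in_Stb)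

lemma haar_eq: "haar = (\<Sum>c \<in> Cyc n. cscale (1 / of_nat n) (bvec (id, c)))"
proof -
  have "haar = (\<Sum>v \<in> JB n. cscale (haar v * 1) (bvec v))"
    by (simp, rule sum_cscale_bvec[symmetric, OF finite_JB]) (use haar_in_J in \<open>auto simp: J_def\<close>)
  then show ?thesis unfolding sum_haar .
qed

lemma J_counit_eq: "J_counit n f = (\<Sum>b \<in> Cyc n. f (id, b))"
proof -
  have "J_counit n f = (\<Sum>b \<in> Cyc n. \<Sum>y \<in> Stb n. if y = id then f (id, b) else 0)"
    unfolding J_counit_def sum_JB by (intro sum.cong) auto
  then show ?thesis using finite_Stb id_in_Stb by simp
qed

lemma J_counit_haar: "J_counit n haar = 1"
  using n_pos by (simp add: J_counit_eq haar_def card_Cyc)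

lemma sum_Cyc_translate:
  assumes "b \<in> Cyc n"
  shows "(\<Sum>c \<in> Cyc n. g (b \<circ> c)) = (\<Sum>c \<in> Cyc n. g c)"
  using assms Cyc_comp_inv[OF assms] Cyc_comp Cyc_inv
  by (intro sum.reindex_bij_witness[of _ "\<lambda>c. inv' b \<circ> c" "\<lambda>c. b \<circ> c"]) (auto simp: o_assoc)

lemma haar_translate:
  assumes "b \<in> Cyc n"
  shows "(\<Sum>c \<in> Cyc n. cscale (k / of_nat n) (bvec (id, b \<circ> c))) = cscale k haar"
proof -
  have "(\<Sum>c \<in> Cyc n. cscale (k / of_nat n) (bvec (id, b \<circ> c)))
      = (\<Sum>c \<in> Cyc n. cscale (k / of_nat n) (bvec (id, c)))"
    using sum_Cyc_translate[OF assms, of "\<lambda>c. cscale (k / of_nat n) (bvec (id, c))"] .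
  then show ?thesis by (simp add: haar_eq cfun.scale_sum_right)
qed

text \<open>The rotations fix the identity permutation under \<open>ract\<close>, so only the
  coefficients of \<open>h\<close> at \<open>(id, b)\<close> survive. Multiplication by
  \<open>b\<close> then merely permutes the summands of \<open>haar\<close>.\<close>

lemma J_mult_haar:
  shows "J_mult n h haar = cscale (J_counit n h) haar"
    and "J_mult n haar h = cscale (J_counit n h) haar"
proof -
  have "J_mult n h haar = (\<Sum>u \<in> JB n. \<Sum>v \<in> JB n. cscale (haar v * h u)
     (if fst v = ract n (fst u) (snd u) then bvec (fst u, snd u \<circ> snd v) else 0))"
    by (simp add: J_mult_alt mult.commute)
  also have "\<dots> = (\<Sum>b \<in> Cyc n. \<Sum>y \<in> Stb n. if y = id then
      (\<Sum>c \<in> Cyc n. cscale (h (id, b) / of_nat n) (bvec (id, b \<circ> c))) else 0)"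
  proof -
    have "id = ract n y b \<longleftrightarrow> y = id" if "b \<in> Cyc n" "y \<in> Stb n" for b y
      using ract_cancel[OF that(2) id_in_Stb that(1)] ract_of_id[OF Cyc_inv[OF that(1)]] by auto
    then show ?thesis unfolding sum_haar unfolding sum_JB
      by (intro sum.cong) auto
  qed
  also have "\<dots> = (\<Sum>b \<in> Cyc n. cscale (h (id, b)) haar)"
    using finite_Stb id_in_Stb by (simp add: haar_translate)
  finally show "J_mult n h haar = cscale (J_counit n h) haar"
    by (simp add: J_counit_eq cfun.scale_sum_left)
  have "J_mult n haar h = (\<Sum>v \<in> JB n. \<Sum>u \<in> JB n. cscale (haar u * h v)
     (if fst v = ract n (fst u) (snd u) then bvec (fst u, snd u \<circ> snd v) else 0))"
    unfolding J_mult_alt by (rule sum.swap)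
  also have "\<dots> = (\<Sum>b \<in> Cyc n. \<Sum>y \<in> Stb n. if y = id then
      (\<Sum>c \<in> Cyc n. cscale (h (id, b) / of_nat n) (bvec (id, b \<circ> c))) else 0)"
    unfolding sum_haar unfolding sum_JB
    by (intro sum.cong) (auto simp: ract_of_id Cyc_comm)
  also have "\<dots> = (\<Sum>b \<in> Cyc n. cscale (h (id, b)) haar)"
    using finite_Stb id_in_Stb by (simp add: haar_translate)
  finally show "J_mult n haar h = cscale (J_counit n h) haar"
    by (simp add: J_counit_eq cfun.scale_sum_left)
qed

text \<open>Uniqueness is the usual argument: the product of two normalized two-sided integrals
  equals each of them.\<close>

lemma J_integral_eq: "J_integral n = haar"
  unfolding J_integral_def
proof (rule the_equality)
  fix L assume L: "L \<in> J n \<and> J_counit n L = 1 \<and>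
     (\<forall>h \<in> J n. J_mult n h L = cscale (J_counit n h) L \<and> J_mult n L h = cscale (J_counit n h) L)"
  then have "J_mult n haar L = L" using haar_in_J J_counit_haar by simp
  moreover have "J_mult n haar L = haar" using J_mult_haar(2)[of L] L by simp
  ultimately show "L = haar" by simp
qed (use haar_in_J J_counit_haar J_mult_haar in auto)

lemma J_comult_haar:
  "J_comult n haar = (\<Sum>b \<in> Cyc n. \<Sum>z \<in> Stb n.
     cscale (1 / of_nat n) (bvec ((inv' z, lact n z b), (z, b))))"
proof -
  have "J_comult n haar = (\<Sum>v \<in> JB n. cscale (haar v * 1)
      (\<Sum>z \<in> Stb n. bvec ((fst v \<circ> inv' z, lact n z (snd v)), (z, snd v))))"
    by (simp add: J_comult_def split_def cfun.scale_sum_right)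
  also have "\<dots> = (\<Sum>b \<in> Cyc n. \<Sum>z \<in> Stb n.
     cscale (1 / of_nat n) (bvec ((inv' z, lact n z b), (z, b))))"
    unfolding sum_haar by (simp add: cfun.scale_sum_right)
  finally show ?thesis .
qed

text \<open>The left side is the condition under which the product of the two tensor factors indexed
  by \<open>z\<close> and \<open>b\<close> in the coproduct of \<open>haar\<close> is
  nonzero.\<close>

lemma ract_inv_iff:
  assumes "z \<in> Stb n" "b \<in> Cyc n"
  shows "z = ract n (inv' z) (lact n z b) \<longleftrightarrow> ract n z b = inv' z"
  using ract_inverse(1)[OF assms] Stb_inv_inv act(3)[OF assms] assms by metis

text \<open>Each summand of the coproduct is a single basis tensor, so the double sum over
  \<open>JB n\<close> collapses to the product of its two factors.\<close>

lemma J_integral_sq_eq: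
  "J_integral_sq n = (\<Sum>b \<in> Cyc n. \<Sum>y \<in> Stb n. cscale (1 / of_nat n)
     (if ract n (inv' y) b = y then bvec (y, lact n (inv' y) b \<circ> b) else 0))"
proof -
  define G :: "(perm \<times> perm) \<times> (perm \<times> perm) \<Rightarrow> jvec"
    where "G = (\<lambda>(u, v). J_mult n (bvec u) (bvec v))"
  have "J_integral_sq n = (\<Sum>w \<in> JB n \<times> JB n. cscale (J_comult n haar w) (G w))"
    by (simp add: J_integral_sq_def J_integral_eq G_def sum.cartesian_product split_def)
  also have "\<dots> = (\<Sum>w \<in> JB n \<times> JB n. \<Sum>b \<in> Cyc n. \<Sum>z \<in> Stb n.
      cscale (bvec ((inv' z, lact n z b), (z, b)) w * (1 / of_nat n)) (G w))"
    by (simp add: J_comult_haar sum_fun_apply cfun.scale_sum_left cscale_def[of _ "bvec _"] mult.commute)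
  also have "\<dots> = (\<Sum>b \<in> Cyc n. \<Sum>z \<in> Stb n. \<Sum>w \<in> JB n \<times> JB n.
      cscale (bvec ((inv' z, lact n z b), (z, b)) w * (1 / of_nat n)) (G w))"
    by (subst sum.swap) (intro sum.cong refl, rule sum.swap)
  also have "\<dots> = (\<Sum>b \<in> Cyc n. \<Sum>z \<in> Stb n.
      cscale (1 / of_nat n) (G ((inv' z, lact n z b), (z, b))))"
    using finite_JB act(2) Stb_inv
    by (intro sum.cong refl, subst sum_cscale_bvec_mult) (auto simp: JB_def)
  also have "\<dots> = (\<Sum>b \<in> Cyc n. \<Sum>z \<in> Stb n. cscale (1 / of_nat n)
      (if ract n z b = inv' z then bvec (inv' z, lact n z b \<circ> b) else 0))"
    using act(2) Stb_inv by (intro sum.cong refl) (auto simp: G_def J_mult_bvec ract_inv_iff)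
  \<comment> \<open>The substitution \<open>y = inv' z\<close> makes \<open>y\<close> the first
    index of the resulting basis vector.\<close>
  also have "\<dots> = (\<Sum>b \<in> Cyc n. \<Sum>y \<in> Stb n. cscale (1 / of_nat n)
     (if ract n (inv' y) b = y then bvec (y, lact n (inv' y) b \<circ> b) else 0))"
    using Stb_inv Stb_inv_inv
    by (intro sum.cong refl sum.reindex_bij_witness[of _ inv' inv']) auto
  finally show ?thesis .
qed

section \<open>Characters and indicators of the induced modules\<close>

lemma stab_subset_Cyc: "stab n x \<subseteq> Cyc n"
  by (auto simp: stab_def)

lemma id_in_stab: "x \<in> Stb n \<Longrightarrow> id \<in> stab n x"
  by (simp add: stab_def id_in_Cyc ract_id)

lemma stab_comp: "x \<in> Stb n \<Longrightarrow> g \<in> stab n x \<Longrightarrow> h \<in> stab n x \<Longrightarrow> g \<circ> h \<in> stab n x"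
  by (simp add: stab_def Cyc_comp act_comp)

lemma stab_inv: "x \<in> Stb n \<Longrightarrow> g \<in> stab n x \<Longrightarrow> inv' g \<in> stab n x"
  using ract_cancel[of x x g] by (auto simp: stab_def Cyc_inv)

lemma sum_stab_translate:
  assumes x: "x \<in> Stb n" and h: "h \<in> stab n x"
  shows "(\<Sum>g \<in> stab n x. G (h \<circ> g)) = (\<Sum>g \<in> stab n x. G g)"
proof -
  have "h \<in> Cyc n" using h stab_subset_Cyc by blast
  then show ?thesis
    using Cyc_comp_inv[of h] stab_comp[OF x] stab_inv[OF x] h
    by (intro sum.reindex_bij_witness[of _ "\<lambda>c. inv' h \<circ> c" "\<lambda>c. h \<circ> c"]) (auto simp: o_assoc)
qed

text \<open>Residues modulo \<open>t\<close> separate the cosets of the stabilizer, so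
  \<open>rot 0\<close> up to \<open>rot (t - 1)\<close> represent distinct cosets.\<close>

lemma rot_comp_stab_eq:
  assumes t: "t dvd n" and x: "x \<in> M n t" and "r < t" "s < t" "g \<in> stab n x" "h \<in> stab n x"
    and eq: "rot r \<circ> g = rot s \<circ> h"
  shows "r = s" "g = h"
proof -
  obtain k l where k: "g = rot (t * k)" and l: "h = rot (t * l)"
    using assms(5,6) stab_M[OF x] by auto
  have "[r + t * k = s + t * l] (mod n)" using eq unfolding k l rot_comp rot_eq_iff .
  then have "[r + t * k = s + t * l] (mod t)" using t cong_dvd_modulus_nat by blast
  then show rs: "r = s" using assms(3,4) by (simp add: cong_def)
  have "rot ((n - 1) * r) \<circ> (rot r \<circ> g) = rot ((n - 1) * r) \<circ> (rot r \<circ> h)" using eq rs by simp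
  then show "g = h" unfolding o_assoc rot_neg by simp
qed

lemma sum_Cyc_cosets:
  assumes t: "t dvd n" and x: "x \<in> M n t"
  shows "(\<Sum>c \<in> Cyc n. G c) = (\<Sum>s < t. \<Sum>g \<in> stab n x. G (rot s \<circ> g))"
proof -
  have t0: "0 < t" using t n_pos by (simp add: dvd_pos_nat)
  have "bij_betw (\<lambda>(s, g). rot s \<circ> g) ({..<t} \<times> stab n x) (Cyc n)"
    unfolding bij_betw_def
  proof
    show "inj_on (\<lambda>(s, g). rot s \<circ> g) ({..<t} \<times> stab n x)"
      using rot_comp_stab_eq[OF t x] by (auto intro!: inj_onI)
    show "(\<lambda>(s, g). rot s \<circ> g) ` ({..<t} \<times> stab n x) = Cyc n"
    proof (intro equalityI subsetI)
      fix c assume "c \<in> Cyc n"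
      then obtain r where "c = rot r" by (auto simp: Cyc_eq)
      then have "c = rot (r mod t) \<circ> rot (t * (r div t))" by (simp add: rot_comp)
      then show "c \<in> (\<lambda>(s, g). rot s \<circ> g) ` ({..<t} \<times> stab n x)"
        using t0 stab_M[OF x] by (intro image_eqI[of _ _ "(r mod t, rot (t * (r div t)))"]) auto
    qed (auto intro!: Cyc_comp rot_in_Cyc intro: subsetD[OF stab_subset_Cyc[of x]])
  qed
  from sum.reindex_bij_betw[OF this, of G] show ?thesis
    by (simp add: sum.cartesian_product split_def)
qed

text \<open>The classes of \<open>rot s\<close> tensor 1 for \<open>s < t\<close> form a basis of
  the induced module. The trace is computed by \<open>quot_trace_dual_basis\<close> from functionals
  reading off the coordinates in this basis.\<close>

lemma ind_character_dim_1:
  assumes t: "t dvd n" and x: "x \<in> M n t" and rep: "is_rep (stab n x) (1, \<rho>)"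
  shows "ind_character n x (1, \<rho>) h = (\<Sum>s < t. \<Sum>u \<in> JB n.
    h u * (if snd u \<in> stab n x \<and> ract n (fst u) (rot s) = x then \<rho> (snd u) $$ (0, 0) else 0))"
proof -
  define F where "F = stab n x"
  define \<chi> where "\<chi> g = \<rho> g $$ (0, 0)" for g
  have xS: "x \<in> Stb n" using x M_subset_Stb by blast
  have FC: "\<And>g. g \<in> F \<Longrightarrow> g \<in> Cyc n" using stab_subset_Cyc by (auto simp: F_def)
  have finF: "finite F" unfolding F_def by (rule finite_subset[OF stab_subset_Cyc finite_Cyc])
  have idF: "id \<in> F" using id_in_stab[OF xS] by (simp add: F_def)
  have carr: "\<And>g. g \<in> F \<Longrightarrow> \<rho> g \<in> carrier_mat 1 1" using rep by (auto simp: is_rep_def F_def)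
  have \<chi>_id: "\<chi> id = 1" using rep by (auto simp: is_rep_def \<chi>_def)
  have \<chi>_comp: "\<chi> (g \<circ> h) = \<chi> g * \<chi> h" if "g \<in> F" "h \<in> F" for g h
    using rep that index_mult_mat_1[OF carr[OF that(1)] carr[OF that(2)]]
    by (simp add: is_rep_def \<chi>_def F_def)
  define W where "W = ind_space n (1, \<rho>)"
  \<comment> \<open>Modulo the relations, \<open>rot s \<circ> g\<close> tensor 1 equals
    \<open>\<chi> g\<close> times \<open>rot s\<close> tensor 1. Collecting the coset of
    \<open>rot s\<close> with these weights gives the coordinate.\<close>
  define \<phi> where "\<phi> s w = (\<Sum>g \<in> F. \<chi> g * w (rot s \<circ> g, 0))" for s and w :: ivec
  define e :: "nat \<Rightarrow> ivec" where "e s = bvec (rot s, 0)" for s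
  have W_iff: "w \<in> W \<longleftrightarrow> (\<forall>c i. c \<notin> Cyc n \<or> i \<noteq> 0 \<longrightarrow> w (c, i) = 0)" for w
    by (auto simp: W_def ind_space_def)
  have W_sub: "cfun.subspace W" by (auto simp: cfun.subspace_def W_iff cscale_def)
  have bW: "bvec (c, 0) \<in> W" if "c \<in> Cyc n" for c
    using that by (auto simp: W_iff bvec_def)
  have \<phi>_add: "\<phi> s (u + v) = \<phi> s u + \<phi> s v" for s u v
    by (simp add: \<phi>_def algebra_simps sum.distrib)
  have \<phi>_scale: "\<phi> s (cscale k u) = k * \<phi> s u" for s k u
    by (simp add: \<phi>_def cscale_def sum_distrib_left algebra_simps)
  have \<phi>_0: "\<phi> s 0 = 0" for s by (simp add: \<phi>_def)
  have \<phi>_diff: "\<phi> s (u - v) = \<phi> s u - \<phi> s v" for s u v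
    using \<phi>_add[of s "u - v" v] by simp
  have \<phi>_sum: "\<phi> s (\<Sum>i \<in> A. f i) = (\<Sum>i \<in> A. \<phi> s (f i))" for s A and f :: "'z \<Rightarrow> ivec"
  proof (induction A rule: infinite_finite_induct)
    case (insert i A)
    then show ?case unfolding sum.insert[OF insert(1,2)] \<phi>_add by simp
  qed (simp_all add: \<phi>_0 del: zero_fun_apply)
  have \<phi>_bvec: "\<phi> s (bvec (b \<circ> rot s, 0)) = (if b \<in> F then \<chi> b else 0)" if b: "b \<in> Cyc n" for s b
  proof -
    have "rot s \<circ> g = b \<circ> rot s \<longleftrightarrow> g = b" if "g \<in> F" for g
    proof
      assume "rot s \<circ> g = b \<circ> rot s"
      then have "rot s \<circ> g = rot s \<circ> b" using Cyc_comm[OF b rot_in_Cyc] by simp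
      then have "rot ((n - 1) * s) \<circ> (rot s \<circ> g) = rot ((n - 1) * s) \<circ> (rot s \<circ> b)" by simp
      then show "g = b" unfolding o_assoc rot_neg by simp
    qed (use Cyc_comm[OF b rot_in_Cyc] in simp)
    then have "\<phi> s (bvec (b \<circ> rot s, 0)) = (\<Sum>g \<in> F. if g = b then \<chi> b else 0)"
      unfolding \<phi>_def by (intro sum.cong) (auto simp: bvec_def)
    then show ?thesis using finF by simp
  qed
  \<comment> \<open>Translating the sum by \<open>g\<close> extracts the factor
    \<open>\<chi> g\<close>; this is why the functionals vanish on the relations.\<close>
  have \<phi>_comp: "\<phi> s (bvec (c \<circ> g, 0)) = \<chi> g * \<phi> s (bvec (c, 0))"
    if c: "c \<in> Cyc n" and g: "g \<in> F" for s c g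
  proof -
    have cancel: "rot s \<circ> (g \<circ> k) = c \<circ> g \<longleftrightarrow> rot s \<circ> k = c" if k: "k \<in> F" for k
    proof -
      have "rot s \<circ> (g \<circ> k) = (rot s \<circ> k) \<circ> g"
        using Cyc_comm[OF FC[OF g] FC[OF k]] by (simp add: o_assoc)
      moreover have "(rot s \<circ> k) \<circ> g = c \<circ> g \<longleftrightarrow> rot s \<circ> k = c"
        using Cyc_comp_inv(1)[OF FC[OF g]] by (metis comp_id o_assoc)
      ultimately show ?thesis by simp
    qed
    have "\<phi> s (bvec (c \<circ> g, 0)) = (\<Sum>k \<in> F. \<chi> (g \<circ> k) * bvec (c \<circ> g, 0 :: nat) (rot s \<circ> (g \<circ> k), 0))"
      unfolding \<phi>_def F_def
      by (rule sum_stab_translate[OF xS g[unfolded F_def], symmetric,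
          of "\<lambda>k. \<chi> k * bvec (c \<circ> g, 0 :: nat) (rot s \<circ> k, 0)"])
    also have "\<dots> = (\<Sum>k \<in> F. \<chi> g * (\<chi> k * bvec (c, 0 :: nat) (rot s \<circ> k, 0)))"
      using g by (intro sum.cong refl) (auto simp: \<chi>_comp bvec_def cancel)
    finally show ?thesis by (simp add: \<phi>_def sum_distrib_left)
  qed
  have dual: "\<phi> r (e s) = (if r = s then 1 else 0)" if "r \<in> {..<t}" "s \<in> {..<t}" for r s
  proof -
    have "rot r \<circ> g = rot s \<longleftrightarrow> r = s \<and> g = id" if "g \<in> F" for g
      using rot_comp_stab_eq[OF t x, of r s g id] that idF \<open>r \<in> {..<t}\<close> \<open>s \<in> {..<t}\<close> by (auto simp: F_def)
    then have "\<phi> r (e s) = (\<Sum>g \<in> F. if g = id then (if r = s then \<chi> id else 0) else 0)"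
      unfolding \<phi>_def e_def by (intro sum.cong) (auto simp: bvec_def)
    then show ?thesis using finF idF \<chi>_id by simp
  qed
  define R where "R = ind_rels n x (1, \<rho>)"
  have R_span: "R = cfun.span
     {cscale (v $ 0) (bvec (c \<circ> g, 0)) - cscale (\<chi> g * v $ 0) (bvec (c, 0)) | c g v.
       c \<in> Cyc n \<and> g \<in> F \<and> v \<in> carrier_vec 1}" (is "_ = cfun.span ?X")
    unfolding R_def ind_rels_def F_def prod.case \<chi>_def
    by (rule arg_cong[of _ _ cfun.span], intro Collect_cong ex_cong1 rev_conj_cong refl)
      (use carr in \<open>auto simp: F_def pure_dim_1 pure_mult_mat_vec_1\<close>)
  have gen: "bvec (c \<circ> g, 0) - cscale (\<chi> g) (bvec (c, 0)) \<in> R" if "c \<in> Cyc n" "g \<in> F" for c g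
  proof -
    have "cscale (vec 1 (\<lambda>_. 1) $ 0) (bvec (c \<circ> g, 0)) - cscale (\<chi> g * vec 1 (\<lambda>_. 1) $ 0) (bvec (c, 0)) \<in> ?X"
      using that vec_carrier[of 1 "\<lambda>_. 1"] by blast
    then show ?thesis unfolding R_span by (intro cfun.span_base) simp
  qed
  have R_iff: "w \<in> R \<longleftrightarrow> (\<forall>s \<in> {..<t}. \<phi> s w = 0)" if w: "w \<in> W" for w
  proof
    assume "w \<in> R"
    then have "\<forall>s. \<phi> s w = 0" unfolding R_span
    proof (induction rule: cfun.span_induct)
      case base
      then show ?case
        by (auto simp: cfun.subspace_def \<phi>_0 \<phi>_add \<phi>_scale simp del: plus_fun_apply zero_fun_apply)
    next
      case (step w)
      then show ?case by (auto simp: \<phi>_diff \<phi>_scale \<phi>_comp simp del: minus_apply)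
    qed
    then show "\<forall>s \<in> {..<t}. \<phi> s w = 0" by simp
  next
    assume 0: "\<forall>s \<in> {..<t}. \<phi> s w = 0"
    have "w = (\<Sum>p \<in> Cyc n \<times> {0}. cscale (w p) (bvec p))"
      using w finite_Cyc by (subst sum_cscale_bvec) (auto simp: W_iff)
    also have "\<dots> = (\<Sum>c \<in> Cyc n. cscale (w (c, 0)) (bvec (c, 0)))"
      by (simp add: sum.cartesian_product')
    also have "\<dots> = (\<Sum>s < t. \<Sum>g \<in> F. cscale (w (rot s \<circ> g, 0)) (bvec (rot s \<circ> g, 0)))"
      unfolding F_def by (rule sum_Cyc_cosets[OF t x])
    finally have w_eq: "w = (\<Sum>s < t. \<Sum>g \<in> F. cscale (w (rot s \<circ> g, 0)) (bvec (rot s \<circ> g, 0)))" .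
    have zero: "(\<Sum>g \<in> F. cscale (w (rot s \<circ> g, 0)) (cscale (\<chi> g) (e s))) = 0" if "s < t" for s
    proof -
      have "(\<Sum>g \<in> F. cscale (w (rot s \<circ> g, 0)) (cscale (\<chi> g) (e s)))
          = cscale (\<phi> s w) (e s)"
        by (simp add: \<phi>_def cfun.scale_sum_left mult.commute)
      then show ?thesis using 0 that by simp
    qed
    \<comment> \<open>Subtracting the coordinate expansion changes nothing, as all coordinates
      vanish, and turns each term into a multiple of a generator of the relations.\<close>
    have "w = (\<Sum>s < t. \<Sum>g \<in> F. cscale (w (rot s \<circ> g, 0)) (bvec (rot s \<circ> g, 0)))
        - (\<Sum>s < t. \<Sum>g \<in> F. cscale (w (rot s \<circ> g, 0)) (cscale (\<chi> g) (e s)))"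
    proof -
      have "(\<Sum>s < t. \<Sum>g \<in> F. cscale (w (rot s \<circ> g, 0)) (cscale (\<chi> g) (e s))) = 0"
        by (intro sum.neutral ballI zero) simp
      then show ?thesis unfolding w_eq[symmetric] by (simp only: diff_zero)
    qed
    also have "\<dots> = (\<Sum>s < t. \<Sum>g \<in> F. cscale (w (rot s \<circ> g, 0))
        (bvec (rot s \<circ> g, 0) - cscale (\<chi> g) (e s)))"
      by (simp only: sum_subtractf cfun.scale_right_diff_distrib)
    also have "\<dots> \<in> R"
      using gen rot_in_Cyc unfolding R_span
      by (intro cfun.span_sum cfun.span_scale) (auto simp: R_span e_def)
    finally show "w \<in> R" .
  qed
  define f where "f = ind_act n x (1, \<rho>) h"
  have f_eq: "f w = (\<Sum>u \<in> JB n. \<Sum>c \<in> Cyc n. cscale (h u * w (c, 0))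
      (if ract n (fst u) (snd u \<circ> c) = x then bvec (snd u \<circ> c, 0) else 0))" for w
  proof -
    have 1: "{..<1} = {0 :: nat}" by auto
    show ?thesis
      unfolding f_def ind_act_def split_def sum.cartesian_product' fst_conv snd_conv 1 by simp
  qed
  have f_W: "f w \<in> W" for w
    unfolding f_eq
    by (intro cfun.subspace_sum[OF W_sub] cfun.subspace_scale[OF W_sub])
      (auto simp: JB_def intro!: bW Cyc_comp cfun.subspace_0[OF W_sub])
  \<comment> \<open>The coordinate at \<open>r\<close> of \<open>h\<close> applied to
    \<open>e s\<close>.\<close>
  define A where "A r s = (\<Sum>u \<in> JB n. h u *
      (if ract n (fst u) (snd u \<circ> rot s) = x then \<phi> r (bvec (snd u \<circ> rot s, 0)) else 0))" for r s
  have stab_act: "ract n y (b \<circ> g) = x \<longleftrightarrow> ract n y b = x"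
    if y: "y \<in> Stb n" and b: "b \<in> Cyc n" and g: "g \<in> F" for y b g
  proof -
    have "ract n y (b \<circ> g) = ract n (ract n y b) g" using act_comp y b FC[OF g] by simp
    moreover have "ract n (ract n y b) g = x \<longleftrightarrow> ract n y b = ract n x (inv' g)"
      using ract_cancel[OF act(3)[OF y b] xS FC[OF g]] .
    moreover have "ract n x (inv' g) = x"
      using stab_inv[OF xS] g by (auto simp: F_def stab_def)
    ultimately show ?thesis by simp
  qed
  have A: "\<phi> r (f w) = (\<Sum>s < t. A r s * \<phi> s w)" for r w
  proof -
    have "\<phi> r (f w) = (\<Sum>u \<in> JB n. \<Sum>c \<in> Cyc n. h u * w (c, 0) *
        (if ract n (fst u) (snd u \<circ> c) = x then \<phi> r (bvec (snd u \<circ> c, 0)) else 0))"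
      unfolding f_eq \<phi>_sum by (intro sum.cong refl) (auto simp: \<phi>_scale \<phi>_0)
    also have "\<dots> = (\<Sum>u \<in> JB n. \<Sum>s < t. \<Sum>g \<in> F. h u * w (rot s \<circ> g, 0) *
        (if ract n (fst u) (snd u \<circ> (rot s \<circ> g)) = x then \<phi> r (bvec (snd u \<circ> (rot s \<circ> g), 0)) else 0))"
      unfolding F_def by (intro sum.cong refl sum_Cyc_cosets[OF t x])
    also have "\<dots> = (\<Sum>u \<in> JB n. \<Sum>s < t. \<Sum>g \<in> F. (h u *
        (if ract n (fst u) (snd u \<circ> rot s) = x then \<phi> r (bvec (snd u \<circ> rot s, 0)) else 0)) *
        (\<chi> g * w (rot s \<circ> g, 0)))"
    proof (intro sum.cong refl)
      fix u s g assume u: "u \<in> JB n" and g: "g \<in> F"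
      have b: "fst u \<in> Stb n" "snd u \<circ> rot s \<in> Cyc n"
        using u Cyc_comp rot_in_Cyc by (auto simp: JB_def)
      show "h u * w (rot s \<circ> g, 0) *
        (if ract n (fst u) (snd u \<circ> (rot s \<circ> g)) = x then \<phi> r (bvec (snd u \<circ> (rot s \<circ> g), 0)) else 0)
        = (h u * (if ract n (fst u) (snd u \<circ> rot s) = x then \<phi> r (bvec (snd u \<circ> rot s, 0)) else 0)) *
        (\<chi> g * w (rot s \<circ> g, 0))"
        unfolding o_assoc stab_act[OF b g] \<phi>_comp[OF b(2) g] by simp
    qed
    also have "\<dots> = (\<Sum>s < t. A r s * \<phi> s w)"
      unfolding A_def \<phi>_def[of _ w] sum_distrib_left sum_distrib_right
      by (subst sum.swap) (intro sum.cong refl, rule sum.swap)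
    finally show ?thesis .
  qed
  have "ind_character n x (1, \<rho>) h = quot_trace W R f"
    by (simp add: ind_character_def W_def R_def f_def)
  also have "\<dots> = (\<Sum>s \<in> {..<t}. A s s)"
    using W_sub bW rot_in_Cyc dual \<phi>_add \<phi>_scale R_iff f_W A
    by (intro quot_trace_dual_basis[where e = e and \<phi> = \<phi>]) (auto simp: e_def)
  also have "\<dots> = (\<Sum>s < t. \<Sum>u \<in> JB n.
    h u * (if snd u \<in> stab n x \<and> ract n (fst u) (rot s) = x then \<rho> (snd u) $$ (0, 0) else 0))"
    unfolding A_def
  proof (intro sum.cong refl arg_cong2[of _ _ _ _ "(*)"])
    fix u s assume "u \<in> JB n"
    then have u: "fst u \<in> Stb n" "snd u \<in> Cyc n" by (auto simp: JB_def)
    \<comment> \<open>On the diagonal \<open>\<phi>_bvec\<close> leaves only rotations in the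
      stabilizer. Moved past \<open>rot s\<close>, such a rotation drops out of the
      condition.\<close>
    have "ract n (fst u) (snd u \<circ> rot s) = x \<longleftrightarrow> ract n (fst u) (rot s) = x" if "snd u \<in> F"
      using stab_act[OF u(1) rot_in_Cyc that, of s] Cyc_comm[OF u(2) rot_in_Cyc] by simp
    then show "(if ract n (fst u) (snd u \<circ> rot s) = x then \<phi> s (bvec (snd u \<circ> rot s, 0)) else 0)
      = (if snd u \<in> stab n x \<and> ract n (fst u) (rot s) = x then \<rho> (snd u) $$ (0, 0) else 0)"
      unfolding \<phi>_bvec[OF u(2)] by (auto simp: F_def \<chi>_def)
  qed
  finally show ?thesis .
qed

section \<open>Evaluation of the indicator\<close>

lemma sum_J_integral_sq:
  "(\<Sum>u \<in> JB n. J_integral_sq n u * g u) = (\<Sum>b \<in> Cyc n. \<Sum>y \<in> Stb n.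
     (if ract n (inv' y) b = y then g (y, lact n (inv' y) b \<circ> b) else 0) / of_nat n)"
proof -
  have "(\<Sum>u \<in> JB n. J_integral_sq n u * g u) = (\<Sum>u \<in> JB n. \<Sum>b \<in> Cyc n. \<Sum>y \<in> Stb n.
      (if ract n (inv' y) b = y then bvec (y, lact n (inv' y) b \<circ> b) u * g u else 0) / of_nat n)"
    unfolding J_integral_sq_eq sum_fun_apply sum_distrib_right
    by (intro sum.cong refl) (auto simp: cscale_def)
  also have "\<dots> = (\<Sum>b \<in> Cyc n. \<Sum>y \<in> Stb n. \<Sum>u \<in> JB n.
      (if ract n (inv' y) b = y then bvec (y, lact n (inv' y) b \<circ> b) u * g u else 0) / of_nat n)"
    by (subst sum.swap) (intro sum.cong refl, rule sum.swap)
  also have "\<dots> = (\<Sum>b \<in> Cyc n. \<Sum>y \<in> Stb n.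
     (if ract n (inv' y) b = y then g (y, lact n (inv' y) b \<circ> b) else 0) / of_nat n)"
  proof (intro sum.cong refl)
    fix b y assume yb: "b \<in> Cyc n" "y \<in> Stb n"
    then have "(y, lact n (inv' y) b \<circ> b) \<in> JB n"
      using act(2)[OF Stb_inv] Cyc_comp by (auto simp: JB_def)
    then show "(\<Sum>u \<in> JB n. (if ract n (inv' y) b = y
        then bvec (y, lact n (inv' y) b \<circ> b) u * g u else 0) / of_nat n)
      = (if ract n (inv' y) b = y then g (y, lact n (inv' y) b \<circ> b) else 0) / of_nat n"
      using sum_bvec_mult[OF finite_JB, of "(y, lact n (inv' y) b \<circ> b)" g]
      by (simp add: sum_divide_distrib[symmetric])
  qed
  finally show ?thesis .
qed

text \<open>The condition \<open>ract n z (rot s) = x\<close> determines \<open>z\<close>, so the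
  sum over \<open>Stb n\<close> reduces to one orbit point \<open>y s\<close> for each
  \<open>s\<close>. The equation for \<open>y\<close> is an abbreviation that callers discharge by
  reflexivity.\<close>

lemma fs_indicator_dim_1:
  assumes t: "t dvd n" and x: "x \<in> M n t" and rep: "is_rep (stab n x) (1, \<rho>)"
    and y: "\<And>s. y s = ract n x (inv' (rot s))"
  shows "fs_indicator n x (1, \<rho>) = (\<Sum>s < t. \<Sum>b \<in> Cyc n.
    (if ract n (inv' (y s)) b = y s \<and> lact n (inv' (y s)) b \<circ> b \<in> stab n x
     then \<rho> (lact n (inv' (y s)) b \<circ> b) $$ (0, 0) else 0) / of_nat n)"
proof -
  have xS: "x \<in> Stb n" using x M_subset_Stb by blast
  show ?thesis
    unfolding fs_indicator_def ind_character_dim_1[OF t x rep] sum_J_integral_sq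
  proof (intro sum.cong refl)
    fix s b
    let ?c = "\<lambda>z. lact n (inv' z) b \<circ> b"
    have yS: "y s \<in> Stb n" unfolding y by (rule act(3)[OF xS Cyc_inv[OF rot_in_Cyc]])
    have "(\<Sum>z \<in> Stb n. (if ract n (inv' z) b = z
        then if snd (z, ?c z) \<in> stab n x \<and> ract n (fst (z, ?c z)) (rot s) = x
          then \<rho> (snd (z, ?c z)) $$ (0, 0) else 0 else 0) / of_nat n)
      = (\<Sum>z \<in> Stb n. if z = y s then (if ract n (inv' (y s)) b = y s \<and> ?c (y s) \<in> stab n x
         then \<rho> (?c (y s)) $$ (0, 0) else 0) / of_nat n else 0)"
      using ract_cancel[OF _ xS rot_in_Cyc] by (intro sum.cong refl) (auto simp: y)
    then show "(\<Sum>z \<in> Stb n. (if ract n (inv' z) b = z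
        then if snd (z, ?c z) \<in> stab n x \<and> ract n (fst (z, ?c z)) (rot s) = x
          then \<rho> (snd (z, ?c z)) $$ (0, 0) else 0 else 0) / of_nat n)
      = (if ract n (inv' (y s)) b = y s \<and> ?c (y s) \<in> stab n x
         then \<rho> (?c (y s)) $$ (0, 0) else 0) / of_nat n"
      using finite_Stb yS by simp
  qed
qed

text \<open>Every summand is 0: a solution of \<open>ract n (inv' y) b = y\<close> would put
  \<open>inv' y\<close> into the odd orbit of \<open>y\<close> and so produce an involution
  there.\<close>

lemma fs_indicator_eq_0:
  assumes t: "t dvd n" "odd t" and x: "x \<in> M n t" and rep: "is_rep (stab n x) (1, \<rho>)"
    and no_inv: "orb n x \<inter> involutions n = {}"
  shows "fs_indicator n x (1, \<rho>) = 0"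
proof -
  have xS: "x \<in> Stb n" using x M_subset_Stb by blast
  have "ract n (inv' y) b \<noteq> y" if y: "y \<in> orb n x" and b: "b \<in> Cyc n" for y b
  proof
    assume eq: "ract n (inv' y) b = y"
    have yS: "y \<in> Stb n" using y orb_subset_Stb[OF xS] by blast
    have "inv' y = ract n y (inv' b)" using ract_cancel[OF Stb_inv[OF yS] yS b] eq by simp
    then have "inv' y \<in> orb n y" using Cyc_inv[OF b] by (auto simp: orb_def)
    moreover have "card (orb n y) = t" using M_iff_card_orb[OF t(1)] M_orb[OF t(1) x y] by simp
    ultimately have "orb n y \<inter> involutions n \<noteq> {}"
      using involution_if_inv_mem_odd_orb[OF yS] t(2) by simp
    with no_inv show False using orb_eq_if_mem[OF xS y] by simp
  qed
  moreover have "ract n x (inv' (rot s)) \<in> orb n x" for s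
    using Cyc_inv rot_in_Cyc by (auto simp: orb_def)
  ultimately show ?thesis
    by (subst fs_indicator_dim_1[OF t(1) x rep refl]) (auto intro!: sum.neutral)
qed

lemma stab_M_image:
  assumes t: "t dvd n" and x: "x \<in> M n t"
  shows "stab n x = (\<lambda>k. rot (t * k)) ` {..<n div t}" "inj_on (\<lambda>k. rot (t * k)) {..<n div t}"
proof -
  define m where "m = n div t"
  have n: "n = t * m" using t by (simp add: m_def)
  have tm: "0 < t" "0 < m" using n n_pos by auto
  have "rot (t * k) = rot (t * (k mod m))" for k
    unfolding rot_eq_iff by (simp add: n cong_def flip: mult_mod_right)
  then show "stab n x = (\<lambda>k. rot (t * k)) ` {..<n div t}"
    unfolding stab_M[OF x] m_def[symmetric] using tm
    by (auto simp: image_iff) (metis mod_less_divisor lessThan_iff)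
  show "inj_on (\<lambda>k. rot (t * k)) {..<n div t}"
    unfolding m_def[symmetric]
  proof (rule inj_onI)
    fix k l assume "k \<in> {..<m}" "l \<in> {..<m}" "rot (t * k) = rot (t * l)"
    then have "[t * k = t * l] (mod n)" "k < m" "l < m" by (auto simp: rot_eq_iff)
    then show "k = l" using tm by (simp add: n cong_def flip: mult_mod_right)
  qed
qed

lemma rep_power:
  assumes t: "t dvd n" and x: "x \<in> M n t" and rep: "is_rep (stab n x) (1, \<rho>)"
  shows "\<rho> (rot (t * k)) $$ (0, 0) = (\<rho> (rot t) $$ (0, 0)) ^ k"
    "(\<rho> (rot t) $$ (0, 0)) ^ (n div t) = 1"
proof -
  have mem: "rot (t * k) \<in> stab n x" for k using stab_M[OF x] by auto
  have id: "\<rho> id $$ (0, 0) = 1" using rep by (simp add: is_rep_def)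
  have pow: "\<rho> (rot (t * k)) $$ (0, 0) = (\<rho> (rot t) $$ (0, 0)) ^ k" for k
  proof (induction k)
    case 0
    then show ?case using id by (simp add: id_def)
  next
    case (Suc k)
    have "rot (t * Suc k) = rot t \<circ> rot (t * k)" by (simp add: rot_comp)
    moreover have "\<rho> (rot t \<circ> rot (t * k)) = \<rho> (rot t) * \<rho> (rot (t * k))"
      using rep mem[of 1] mem[of k] by (auto simp: is_rep_def simp del: funpow_mult)
    moreover have "\<rho> (rot t) \<in> carrier_mat 1 1" "\<rho> (rot (t * k)) \<in> carrier_mat 1 1"
      using rep mem[of 1] mem[of k] by (auto simp: is_rep_def)
    ultimately have "\<rho> (rot (t * Suc k)) $$ (0, 0) = \<rho> (rot t) $$ (0, 0) * \<rho> (rot (t * k)) $$ (0, 0)"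
      using index_mult_mat_1 by metis
    then show ?case using Suc by simp
  qed
  then show "\<rho> (rot (t * k)) $$ (0, 0) = (\<rho> (rot t) $$ (0, 0)) ^ k" .
  have "rot (t * (n div t)) = id" using t rot_eq_id_iff by simp
  then show "(\<rho> (rot t) $$ (0, 0)) ^ (n div t) = 1"
    using pow[of "n div t"] id by simp
qed

text \<open>Each of the \<open>t\<close> orbit points contributes the same geometric sum of
  \<open>m\<close> powers of \<open>\<zeta> ^ (j + 1)\<close>, which is \<open>m\<close> or 0. The
  normalization \<open>1 / n\<close> cancels \<open>t * m\<close>.\<close>

lemma fs_indicator_involution:
  assumes t: "t dvd n" and x: "x \<in> M n t"
    and z: "z \<in> orb n x" "z \<circ> z = id"
    and j: "\<And>k. lact n z (rot (t * k)) = rot (t * (j * k))"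
    and rep: "is_rep (stab n x) (1, \<rho>)"
  shows "fs_indicator n x (1, \<rho>) = (if (\<rho> (rot t) $$ (0, 0)) ^ (j + 1) = 1 then 1 else 0)"
proof -
  define m where "m = n div t"
  have n: "n = t * m" using t by (simp add: m_def)
  have tm: "0 < t" "0 < m" using n n_pos by auto
  define \<zeta> where "\<zeta> = \<rho> (rot t) $$ (0, 0)"
  have xS: "x \<in> Stb n" using x M_subset_Stb by blast
  have zS: "z \<in> Stb n" using z orb_subset_Stb[OF xS] by blast
  have zM: "z \<in> M n t" using M_orb[OF t x z(1)] .
  have orb_z: "orb n z = orb n x" using orb_eq_if_mem[OF xS z(1)] .
  have stab_z: "stab n z = stab n x" using stab_eq_if_mem_orb[OF t x z(1)] .
  have sum_eq: "(\<Sum>b \<in> Cyc n. (if ract n (inv' y) b = y \<and> lact n (inv' y) b \<circ> b \<in> stab n x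
     then \<rho> (lact n (inv' y) b \<circ> b) $$ (0, 0) else 0) / of_nat n)
     = (\<Sum>k < m. (\<zeta> ^ (j + 1)) ^ k) / of_nat n" if y: "y \<in> orb n x" for y
  proof -
    have yz: "y \<in> orb n z" using y orb_z by simp
    have yS: "y \<in> Stb n" using y orb_subset_Stb[OF xS] by blast
    have stab_y: "stab n y = stab n x" using stab_eq_if_mem_orb[OF t x y] .
    obtain b where b: "b \<in> Cyc n" "ract n (inv' y) b = y" "lact n (inv' y) b = inv' b"
      using ex_rotation_to_inverse[OF zS z(2) yz] .
    define H where "H c = (if ract n (inv' y) c = y \<and> lact n (inv' y) c \<circ> c \<in> stab n x
      then \<rho> (lact n (inv' y) c \<circ> c) $$ (0, 0) else 0) / of_nat n" for c
    \<comment> \<open>Shifting the summation by the particular solution \<open>b\<close> turns the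
      condition into membership of \<open>f\<close> in the stabilizer; in the argument of
      \<open>\<rho>\<close>, \<open>b\<close> cancels against its inverse.\<close>
    have "H (b \<circ> f) = (if f \<in> stab n x \<and> lact n z f \<circ> f \<in> stab n x
      then \<rho> (lact n z f \<circ> f) $$ (0, 0) else 0) / of_nat n" if f: "f \<in> Cyc n" for f
    proof -
      have "ract n (inv' y) (b \<circ> f) = ract n y f"
        using act_comp(1)[OF Stb_inv[OF yS] b(1) f] b(2) by simp
      then have 1: "ract n (inv' y) (b \<circ> f) = y \<longleftrightarrow> f \<in> stab n x"
        using f unfolding stab_y[symmetric] by (simp add: stab_def)
      have l: "lact n y f \<in> Cyc n" by (rule act(2)[OF yS f])
      have "lact n (inv' y) (b \<circ> f) \<circ> (b \<circ> f) = inv' b \<circ> (lact n y f \<circ> b) \<circ> f"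
        using act_comp(2)[OF Stb_inv[OF yS] b(1) f] b(2,3) by (simp add: o_assoc)
      also have "\<dots> = lact n y f \<circ> f"
        unfolding Cyc_comm[OF l b(1)] using Cyc_comp_inv(2)[OF b(1)] by (simp add: o_assoc)
      finally have 2: "lact n (inv' y) (b \<circ> f) \<circ> (b \<circ> f) = lact n y f \<circ> f" .
      have "lact n y f = lact n z f" if "f \<in> stab n x"
        using lact_stab_eq_if_mem_orb[OF zS yz] that stab_z by simp
      then show ?thesis unfolding H_def 1 2 by auto
    qed
    then have "(\<Sum>b \<in> Cyc n. H b) = (\<Sum>f \<in> Cyc n. (if f \<in> stab n x \<and> lact n z f \<circ> f \<in> stab n x
      then \<rho> (lact n z f \<circ> f) $$ (0, 0) else 0) / of_nat n)"
      unfolding sum_Cyc_translate[OF b(1), of H, symmetric] by (rule sum.cong[OF refl])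
    also have "\<dots> = (\<Sum>f \<in> stab n x. (if lact n z f \<circ> f \<in> stab n x
      then \<rho> (lact n z f \<circ> f) $$ (0, 0) else 0) / of_nat n)"
      using finite_Cyc stab_subset_Cyc by (intro sum.mono_neutral_cong_right) auto
    also have "\<dots> = (\<Sum>k < m. (if lact n z (rot (t * k)) \<circ> rot (t * k) \<in> stab n x
      then \<rho> (lact n z (rot (t * k)) \<circ> rot (t * k)) $$ (0, 0) else 0) / of_nat n)"
      using stab_M_image[OF t x] unfolding m_def by (simp add: sum.reindex)
    also have "\<dots> = (\<Sum>k < m. (\<zeta> ^ (j + 1)) ^ k / of_nat n)"
    proof (intro sum.cong refl)
      fix k
      have "lact n z (rot (t * k)) \<circ> rot (t * k) = rot (t * ((j + 1) * k))"
        unfolding j rot_comp by (simp add: algebra_simps)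
      moreover have "rot (t * ((j + 1) * k)) \<in> stab n x" using stab_M[OF x] by blast
      ultimately show "(if lact n z (rot (t * k)) \<circ> rot (t * k) \<in> stab n x
          then \<rho> (lact n z (rot (t * k)) \<circ> rot (t * k)) $$ (0, 0) else 0) / of_nat n
        = (\<zeta> ^ (j + 1)) ^ k / of_nat n"
        using rep_power(1)[OF t x rep, of "(j + 1) * k"] by (simp only: if_True \<zeta>_def power_mult)
    qed
    finally show ?thesis unfolding H_def by (simp only: sum_divide_distrib)
  qed
  have root: "(\<zeta> ^ (j + 1)) ^ m = 1"
    using rep_power(2)[OF t x rep] by (metis \<zeta>_def m_def mult.commute power_mult power_one)
  have "fs_indicator n x (1, \<rho>) = (\<Sum>s < t. (\<Sum>k < m. (\<zeta> ^ (j + 1)) ^ k) / of_nat n)"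
    by (subst fs_indicator_dim_1[OF t x rep refl], intro sum.cong refl sum_eq)
      (auto simp: orb_def intro!: Cyc_inv rot_in_Cyc)
  also have "\<dots> = (if \<zeta> ^ (j + 1) = 1 then 1 else 0)"
    unfolding sum_powers_root_of_unity[OF root] using tm by (simp add: n)
  finally show ?thesis by (simp add: \<zeta>_def)
qed

section \<open>Isomorphism classes of representations of the stabilizer\<close>

text \<open>All irreducible representations have dimension 1 and are classified by their value at
  the generator \<open>rot t\<close>, an arbitrary root of unity for \<open>n div t\<close>. A
  property that depends only on this value can thus be counted on roots of unity.\<close>

lemma card_irr_classes:
  assumes t: "t dvd n" and x: "x \<in> M n t"
    and Q: "\<And>\<rho>. is_rep (stab n x) (1, \<rho>) \<Longrightarrow> Q (1, \<rho>) \<longleftrightarrow> P (\<rho> (rot t) $$ (0, 0))"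
  shows "card {K \<in> irr_classes (stab n x). \<forall>V \<in> K. Q V} = card {z :: complex. z ^ (n div t) = 1 \<and> P z}"
proof -
  define F where "F = stab n x"
  define m where "m = n div t"
  have n: "n = t * m" using t by (simp add: m_def)
  have tm: "0 < t" "0 < m" using n n_pos by auto
  have F_eq: "F = {rot (t * k) | k. True}" using stab_M[OF x] by (simp add: F_def)
  have mem: "rot (t * k) \<in> F" for k using F_eq by blast
  have dim: "d = 1" if "(d, \<rho>) \<in> irr_reps F" for d \<rho>
  proof (rule irr_rep_dim_1_if_generated[OF that, of "rot t"])
    show "rot t \<in> F" using mem[of 1] by simp
    show "\<exists>k. h = rot t ^^ k" if "h \<in> F" for h using that F_eq by (auto simp: funpow_mult)
    show "rot t ^^ k \<in> F" for k using mem by (simp add: funpow_mult)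
  qed
  define C where "C z = {(d, \<rho>). (d, \<rho>) \<in> irr_reps F \<and> \<rho> (rot t) $$ (0, 0) = z}" for z
  have rep_irr: "is_rep F V" if "V \<in> irr_reps F" for V
    using that by (cases V) (auto simp: irr_reps_def)
  have carr: "\<rho> g \<in> carrier_mat 1 1" if "is_rep F (1, \<rho>)" "g \<in> F" for \<rho> g
    using that by (auto simp: is_rep_def)
  have entry: "\<rho> (rot (t * k)) $$ (0, 0) = (\<rho> (rot t) $$ (0, 0)) ^ k" "(\<rho> (rot t) $$ (0, 0)) ^ m = 1"
    if "is_rep F (1, \<rho>)" for \<rho> k
    using rep_power[OF t x] that by (auto simp: F_def m_def)
  have iso: "((1, \<rho>), (1, \<sigma>)) \<in> rep_iso F \<longleftrightarrow> \<rho> (rot t) $$ (0, 0) = \<sigma> (rot t) $$ (0, 0)"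
    if \<rho>: "(1, \<rho>) \<in> irr_reps F" and \<sigma>: "(1, \<sigma>) \<in> irr_reps F" for \<rho> \<sigma>
  proof
    assume "((1, \<rho>), (1, \<sigma>)) \<in> rep_iso F"
    then obtain A where A: "A \<in> carrier_mat 1 1" "invertible_mat A" "\<And>g. g \<in> F \<Longrightarrow> A * \<rho> g = \<sigma> g * A"
      by (auto simp: rep_iso_def)
    obtain B where B: "A * B = 1\<^sub>m 1" "B * A = 1\<^sub>m (dim_row B)"
      using A(1,2) by (auto simp: invertible_mat_def inverts_mat_def)
    have "B \<in> carrier_mat 1 1"
      using arg_cong[OF B(1), of dim_col] arg_cong[OF B(2), of dim_col] A(1) by auto
    then have "A $$ (0, 0) * B $$ (0, 0) = 1"
      using index_mult_mat_1[OF A(1), of B] B(1) by simp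
    then have nz: "A $$ (0, 0) \<noteq> 0" by auto
    have g: "rot t \<in> F" using mem[of 1] by simp
    have "A $$ (0, 0) * \<rho> (rot t) $$ (0, 0) = \<sigma> (rot t) $$ (0, 0) * A $$ (0, 0)"
      using A(3)[OF g] index_mult_mat_1[OF A(1) carr[OF rep_irr[OF \<rho>] g]] index_mult_mat_1[OF carr[OF rep_irr[OF \<sigma>] g] A(1)]
      by auto
    then show "\<rho> (rot t) $$ (0, 0) = \<sigma> (rot t) $$ (0, 0)" using nz by simp
  next
    assume eq: "\<rho> (rot t) $$ (0, 0) = \<sigma> (rot t) $$ (0, 0)"
    have "\<rho> g = \<sigma> g" if g: "g \<in> F" for g
    proof (rule eq_matI)
      obtain k where k: "g = rot (t * k)" using g F_eq by auto
      show "\<rho> g $$ (i, l) = \<sigma> g $$ (i, l)" if "i < dim_row (\<sigma> g)" "l < dim_col (\<sigma> g)" for i l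
        using that carr[OF rep_irr[OF \<rho>] g] carr[OF rep_irr[OF \<sigma>] g] entry(1)[OF rep_irr[OF \<rho>], of k] entry(1)[OF rep_irr[OF \<sigma>], of k] eq
        by (simp add: k)
    qed (use carr[OF rep_irr[OF \<rho>] g] carr[OF rep_irr[OF \<sigma>] g] in auto)
    then have "1\<^sub>m 1 * \<rho> g = \<sigma> g * 1\<^sub>m 1" if "g \<in> F" for g
      using that carr[OF rep_irr[OF \<rho>] that] carr[OF rep_irr[OF \<sigma>] that] by simp
    moreover have "invertible_mat (1\<^sub>m 1 :: complex mat)"
      by (auto simp: invertible_mat_def inverts_mat_def square_mat.simps intro!: exI[of _ "1\<^sub>m 1"])
    ultimately show "((1, \<rho>), (1, \<sigma>)) \<in> rep_iso F"
      using \<rho> \<sigma> by (auto simp: rep_iso_def intro!: bexI[of _ "1\<^sub>m 1"])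
  qed
  have class_eq: "rep_iso F `` {(1, \<rho>)} = C (\<rho> (rot t) $$ (0, 0))" if \<rho>: "(1, \<rho>) \<in> irr_reps F" for \<rho>
  proof -
    have "(e, \<sigma>) \<in> rep_iso F `` {(1, \<rho>)} \<longleftrightarrow> (e, \<sigma>) \<in> C (\<rho> (rot t) $$ (0, 0))" for e \<sigma>
    proof (cases "(e, \<sigma>) \<in> irr_reps F")
      case True
      then have "e = 1" by (rule dim)
      then show ?thesis using iso[OF \<rho>, of \<sigma>] True by (auto simp: C_def)
    qed (auto simp: C_def rep_iso_def)
    then show ?thesis by auto
  qed
  \<comment> \<open>Besides realizing every root of unity, this keeps the condition on all members
    of a class from holding vacuously.\<close>
  have C_ne: "C z \<noteq> {}" if z: "z ^ m = 1" for z
  proof -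
    \<comment> \<open>The exponent of \<open>g = rot (t * k)\<close> is recovered from its value at
      \<open>n\<close>. The identity gets the exponent \<open>m\<close> instead of 0, which is
      harmless as \<open>z ^ m = 1\<close>.\<close>
    define \<rho> where "\<rho> g = mat 1 1 (\<lambda>_. z ^ (g n div t))" for g :: perm
    have carr: "\<rho> g \<in> carrier_mat 1 1" for g by (simp add: \<rho>_def)
    have e: "\<rho> (rot (t * k)) $$ (0, 0) = z ^ k" for k
    proof -
      have c: "[rot (t * k) n = t * k] (mod t * m)" using rot_n_cong by (simp only: n[symmetric])
      then have "t dvd rot (t * k) n"
        by (metis cong_dvd_iff cong_dvd_modulus_nat dvd_triv_left)
      then obtain l where l: "rot (t * k) n = t * l" by auto
      then have "[l = k] (mod m)" using c tm by (simp add: cong_def flip: mult_mod_right)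
      then show ?thesis using power_eq_if_cong[OF z] l tm by (simp add: \<rho>_def)
    qed
    have "is_rep F (1, \<rho>)"
      unfolding is_rep_def prod.case
    proof (intro conjI ballI)
      show "\<rho> g \<in> carrier_mat 1 1" for g by (rule carr)
      show "\<rho> id = 1\<^sub>m 1"
        using e[of 0] by (intro eq_matI) (auto simp: \<rho>_def id_def)
      fix g h assume "g \<in> F" "h \<in> F"
      then obtain k l where kl: "g = rot (t * k)" "h = rot (t * l)" using F_eq by auto
      have gh: "g \<circ> h = rot (t * (k + l))" by (simp add: kl rot_comp algebra_simps)
      show "\<rho> (g \<circ> h) = \<rho> g * \<rho> h"
      proof (rule eq_matI)
        fix i p assume "i < dim_row (\<rho> g * \<rho> h)" "p < dim_col (\<rho> g * \<rho> h)"
        then have "i = 0" "p = 0" using carr by (auto simp: \<rho>_def)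
        then show "\<rho> (g \<circ> h) $$ (i, p) = (\<rho> g * \<rho> h) $$ (i, p)"
          unfolding gh using index_mult_mat_1[OF carr carr, of g h]
          by (simp only: e kl power_add)
      qed (auto simp: \<rho>_def)
    qed
    then have "(1, \<rho>) \<in> C z" using rep_dim_1_irr e[of 1] by (simp add: C_def)
    then show ?thesis by blast
  qed
  have Q_iff: "(\<forall>V \<in> C z. Q V) \<longleftrightarrow> P z" if "z ^ m = 1" for z
  proof -
    have "Q V \<longleftrightarrow> P z" if "V \<in> C z" for V
    proof -
      obtain d \<rho> where V: "V = (d, \<rho>)" by (cases V)
      have V': "V \<in> irr_reps F" "\<rho> (rot t) $$ (0, 0) = z" using that by (auto simp: C_def V)
      then have d: "d = 1" using dim V by blast
      show ?thesis using Q[of \<rho>] rep_irr[OF V'(1)] V'(2) by (simp add: V d F_def)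
    qed
    then show ?thesis using C_ne[OF that] by blast
  qed
  have "{K \<in> irr_classes F. \<forall>V \<in> K. Q V} = C ` {z. z ^ m = 1 \<and> P z}"
  proof (intro equalityI subsetI)
    fix K assume K: "K \<in> {K \<in> irr_classes F. \<forall>V \<in> K. Q V}"
    then obtain d \<rho> where V: "(d, \<rho>) \<in> irr_reps F" "K = rep_iso F `` {(d, \<rho>)}"
      by (auto simp: irr_classes_def quotient_def)
    have d: "d = 1" using dim[OF V(1)] .
    have "K = C (\<rho> (rot t) $$ (0, 0))" "(\<rho> (rot t) $$ (0, 0)) ^ m = 1"
      using V class_eq entry(2) rep_irr d by auto
    with K Q_iff show "K \<in> C ` {z. z ^ m = 1 \<and> P z}" by blast
  next
    fix K assume "K \<in> C ` {z. z ^ m = 1 \<and> P z}"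
    then obtain z where z: "K = C z" "z ^ m = 1" "P z" by blast
    obtain d \<rho> where V: "(d, \<rho>) \<in> C z" using C_ne[OF z(2)] by auto
    then have V': "(d, \<rho>) \<in> irr_reps F" "\<rho> (rot t) $$ (0, 0) = z" by (auto simp: C_def)
    have d: "d = 1" using dim[OF V'(1)] .
    have "K = rep_iso F `` {(1, \<rho>)}" using class_eq[of \<rho>] V' d z(1) by simp
    then have "K \<in> irr_classes F" using V' d by (auto simp: irr_classes_def quotient_def)
    with z Q_iff show "K \<in> {K \<in> irr_classes F. \<forall>V \<in> K. Q V}" by blast
  qed
  moreover have "inj_on C {z. z ^ m = 1 \<and> P z}"
  proof (rule inj_onI)
    fix z w assume z: "z \<in> {z. z ^ m = 1 \<and> P z}" and eq: "C z = C w"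
    obtain V where "V \<in> C z" using C_ne z by blast
    with eq show "z = w" by (auto simp: C_def)
  qed
  ultimately show ?thesis by (simp add: card_image F_def m_def)
qed

section \<open>Counting\<close>

text \<open>The points counted are the union of the orbits in \<open>S\<close>, which are disjoint
  and all of size \<open>t\<close>.\<close>

lemma card_M_with_orb_in:
  assumes t: "t dvd n" "0 < t" and S: "S \<subseteq> {Q \<in> orb n ` Stb n. card Q = t}"
  shows "card {x \<in> M n t. orb n x \<in> S} = t * card S"
proof -
  have "{x \<in> M n t. orb n x \<in> S} = \<Union>S"
  proof (intro equalityI subsetI)
    fix x assume "x \<in> {x \<in> M n t. orb n x \<in> S}"
    then show "x \<in> \<Union>S" using self_in_orb M_subset_Stb by blast
  next
    fix x assume "x \<in> \<Union>S"
    then obtain y where y: "y \<in> Stb n" "x \<in> orb n y" "orb n y \<in> S" "card (orb n y) = t"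
      using S by blast
    then show "x \<in> {x \<in> M n t. orb n x \<in> S}"
      using orb_eq_if_mem[OF y(1,2)] orb_subset_Stb[OF y(1)] M_iff_card_orb[OF t(1)] by auto
  qed
  moreover have "t * card S = card (\<Union>S)"
  proof (rule card_partition)
    show "finite S" using S finite_Stb finite_subset by fastforce
    show "finite (\<Union>S)"
      by (rule finite_subset[OF _ finite_Stb]) (use S orb_subset_Stb in blast)
    show "A \<inter> B = {}" if AB: "A \<in> S" "B \<in> S" "A \<noteq> B" for A B
    proof (rule ccontr)
      assume "A \<inter> B \<noteq> {}"
      then obtain z where z: "z \<in> A" "z \<in> B" by blast
      have "orb n z = A" "orb n z = B" using z S AB(1,2) orb_eq_if_mem by auto
      with AB(3) show False by simp
    qed
  qed (use S in auto)
  ultimately show ?thesis by simp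
qed

text \<open>Counting with the trivial property gives the positive cardinality
  \<open>n div t\<close>, whereas an infinite set would have \<open>card\<close> equal to 0.\<close>

lemma finite_irr_classes_stab:
  assumes t: "t dvd n" and x: "x \<in> M n t"
  shows "finite (irr_classes (stab n x))"
proof -
  have "n = t * (n div t)" using t by simp
  then have m: "0 < n div t" using n_pos by (metis gr0I mult_is_0)
  have "card {K \<in> irr_classes (stab n x). \<forall>V \<in> K. True} = card {z :: complex. z ^ (n div t) = 1 \<and> True}"
    by (rule card_irr_classes[OF t x]) simp
  then have "card (irr_classes (stab n x)) = n div t" using card_roots_unity_eq[OF m] by simp
  then show ?thesis using m card_gt_0_iff by metis
qed

lemma num_irr_eq:
  assumes t: "t dvd n"
  shows "num_irr n t \<nu> = (\<Sum>x \<in> M n t. card {K \<in> irr_classes (stab n x). \<forall>V \<in> K. fs_indicator n x V = \<nu>})"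
proof -
  have "{(x, K). x \<in> M n t \<and> K \<in> irr_classes (stab n x) \<and> (\<forall>V \<in> K. fs_indicator n x V = \<nu>)}
    = Sigma (M n t) (\<lambda>x. {K \<in> irr_classes (stab n x). \<forall>V \<in> K. fs_indicator n x V = \<nu>})"
    by auto
  then show ?thesis
    unfolding num_irr_def using finite_irr_classes_stab[OF t] finite_subset[OF M_subset_Stb finite_Stb]
    by (simp add: card_SigmaI)
qed

lemma ex_multiplier_orb:
  assumes t: "t dvd n" and x: "x \<in> M n t" and inv: "orb n x \<inter> involutions n \<noteq> {}"
  obtains j where "j \<in> E (n div t)" "\<And>y. y \<in> orb n x \<Longrightarrow> [y t = j * t] (mod n)"
    "\<And>\<rho>. is_rep (stab n x) (1, \<rho>) \<Longrightarrow>
      fs_indicator n x (1, \<rho>) = (if (\<rho> (rot t) $$ (0, 0)) ^ (j + 1) = 1 then 1 else 0)"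
proof -
  have xS: "x \<in> Stb n" using x M_subset_Stb by blast
  obtain z where z: "z \<in> orb n x" "z \<circ> z = id" using inv by (auto simp: involutions_def)
  obtain j where j: "j \<in> E (n div t)" "\<And>k. lact n z (rot (t * k)) = rot (t * (j * k))"
    "\<And>y. y \<in> orb n z \<Longrightarrow> [y t = j * t] (mod n)"
    using ex_multiplier[OF t M_orb[OF t x z(1)] z(2)] by blast
  from that[of j] j(1,3) orb_eq_if_mem[OF xS z(1)] fs_indicator_involution[OF t x z j(2)]
  show thesis by simp
qed

text \<open>Cancelling \<open>t\<close> leaves a congruence modulo \<open>n div t\<close> between
  representatives in \<open>{1..n div t}\<close>. In the sum over \<open>E\<close> each orbit with
  an involution is therefore met only once.\<close>

lemma multiplier_unique:
  assumes t: "t dvd n" and j: "j \<in> E (n div t)" "[a = j * t] (mod n)"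
    and i: "i \<in> E (n div t)" "[a = i * t] (mod n)"
  shows "i = j"
proof -
  define m where "m = n div t"
  have n: "n = t * m" using t by (simp add: m_def)
  have "[t * i = t * j] (mod (t * m))"
    using j(2) i(2) by (metis cong_sym cong_trans mult.commute n)
  then have "[i = j] (mod m)" using n n_pos by (auto simp: cong_def simp flip: mult_mod_right)
  then show ?thesis using i(1) j(1) cong_in_interval_imp_eq[of i m j] by (simp add: E_def m_def)
qed

text \<open>At most one pair \<open>(j, r)\<close> matches the orbit of \<open>x\<close>. Writing
  the count as a sum over all pairs allows the later interchange with the sum over
  \<open>x\<close>.\<close>

lemma card_classes_indicator_1:
  assumes t: "t dvd n" "odd t" and x: "x \<in> M n t"
  shows "card {K \<in> irr_classes (stab n x). \<forall>V \<in> K. fs_indicator n x V = 1}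
    = (\<Sum>j \<in> E (n div t). \<Sum>r = 1..t. alpha j (n div t) * (if orb n x \<in> orbits_at n t r j then 1 else 0))"
proof -
  define m where "m = n div t"
  have "n = t * m" using t by (simp add: m_def)
  then have tm: "0 < t" "0 < m" using n_pos by auto
  have xS: "x \<in> Stb n" using x M_subset_Stb by blast
  have ct: "card (orb n x) = t" using M_iff_card_orb[OF t(1)] x by simp
  have x_in: "x \<in> orb n x" using self_in_orb[OF xS] .
  define r\<^sub>0 where "r\<^sub>0 = card (orb n x \<inter> involutions n)"
  have r0: "r\<^sub>0 \<le> t" unfolding r\<^sub>0_def ct[symmetric] by (rule card_mono[OF finite_orb]) auto
  have orb_at: "orb n x \<in> orbits_at n t r j \<longleftrightarrow> r = r\<^sub>0 \<and> (\<forall>y \<in> orb n x. [y t = j * t] (mod n))" for r j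
    using xS ct by (auto simp: orbits_at_def orbits_def r\<^sub>0_def)
  show ?thesis
  proof (cases "orb n x \<inter> involutions n = {}")
    case True
    have "card {K \<in> irr_classes (stab n x). \<forall>V \<in> K. fs_indicator n x V = 1}
        = card {z :: complex. z ^ (n div t) = 1 \<and> False}"
      using fs_indicator_eq_0[OF t x _ True] by (intro card_irr_classes[OF t(1) x]) auto
    \<comment> \<open>The range of \<open>r\<close> starts at 1, so an orbit without involutions
      contributes nothing.\<close>
    moreover have "r\<^sub>0 = 0" using True by (simp add: r\<^sub>0_def)
    ultimately show ?thesis by (auto simp: orb_at intro!: sum.neutral)
  next
    case False
    obtain j where j: "j \<in> E (n div t)" "\<And>y. y \<in> orb n x \<Longrightarrow> [y t = j * t] (mod n)"
      "\<And>\<rho>. is_rep (stab n x) (1, \<rho>) \<Longrightarrow>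
        fs_indicator n x (1, \<rho>) = (if (\<rho> (rot t) $$ (0, 0)) ^ (j + 1) = 1 then 1 else 0)"
      using ex_multiplier_orb[OF t(1) x False] by blast
    have "card {K \<in> irr_classes (stab n x). \<forall>V \<in> K. fs_indicator n x V = 1}
        = card {z :: complex. z ^ (n div t) = 1 \<and> z ^ (j + 1) = 1}"
      using j(3) by (intro card_irr_classes[OF t(1) x]) auto
    also have "\<dots> = alpha j (n div t)"
      using card_common_roots_of_unity[OF tm(2), of "j + 1"] by (simp add: alpha_def m_def)
    also have "\<dots> = (\<Sum>i \<in> E (n div t). \<Sum>r = 1..t. if i = j \<and> r = r\<^sub>0 then alpha j (n div t) else 0)"
    proof -
      have "r\<^sub>0 \<in> {1..t}"
        using r0 False finite_orb by (auto simp: r\<^sub>0_def Suc_le_eq card_gt_0_iff One_nat_def)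
      then have "(\<Sum>r = 1..t. if i = j \<and> r = r\<^sub>0 then alpha j (n div t) else 0)
          = (if i = j then alpha j (n div t) else 0)" for i
        by (cases "i = j") simp_all
      moreover have "finite (E (n div t))" by (simp add: E_def)
      ultimately show ?thesis using j(1) by simp
    qed
    also have "\<dots> = (\<Sum>i \<in> E (n div t). \<Sum>r = 1..t. alpha i (n div t) *
        (if orb n x \<in> orbits_at n t r i then 1 else 0))"
    proof (intro sum.cong refl)
      fix i r assume i: "i \<in> E (n div t)"
      have "(\<forall>y \<in> orb n x. [y t = i * t] (mod n)) \<longleftrightarrow> i = j"
        using j(2) x_in multiplier_unique[OF t(1) j(1) j(2)[OF x_in] i] by auto
      then show "(if i = j \<and> r = r\<^sub>0 then alpha j (n div t) else 0)
          = alpha i (n div t) * (if orb n x \<in> orbits_at n t r i then 1 else 0)"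
        by (auto simp: orb_at)
    qed
    finally show ?thesis .
  qed
qed

text \<open>The indicator takes only the values 0 and 1, decided by a predicate on the root of unity
  that is constantly false if the orbit has no involution. The two counts are complementary among
  the roots of unity.\<close>

lemma card_classes_indicator:
  assumes t: "t dvd n" "odd t" and x: "x \<in> M n t"
  shows "card {K \<in> irr_classes (stab n x). \<forall>V \<in> K. fs_indicator n x V = 0}
      + card {K \<in> irr_classes (stab n x). \<forall>V \<in> K. fs_indicator n x V = 1} = n div t"
proof -
  define m where "m = n div t"
  have "n = t * m" using t by (simp add: m_def)
  then have m: "0 < m" using n_pos by auto
  obtain P :: "complex \<Rightarrow> bool" where P: "\<And>\<rho>. is_rep (stab n x) (1, \<rho>) \<Longrightarrow>
      fs_indicator n x (1, \<rho>) = (if P (\<rho> (rot t) $$ (0, 0)) then 1 else 0)"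
  proof (cases "orb n x \<inter> involutions n = {}")
    case True
    show thesis by (rule that[of "\<lambda>_. False"]) (use fs_indicator_eq_0[OF t x _ True] in simp)
  next
    case False
    obtain j where "\<And>\<rho>. is_rep (stab n x) (1, \<rho>) \<Longrightarrow>
        fs_indicator n x (1, \<rho>) = (if (\<rho> (rot t) $$ (0, 0)) ^ (j + 1) = 1 then 1 else 0)"
      using ex_multiplier_orb[OF t(1) x False] by blast
    then show thesis by (rule that[of "\<lambda>z. z ^ (j + 1) = 1"])
  qed
  have "card {K \<in> irr_classes (stab n x). \<forall>V \<in> K. fs_indicator n x V = 0}
      = card {z :: complex. z ^ m = 1 \<and> \<not> P z}"
    unfolding m_def using P by (intro card_irr_classes[OF t(1) x]) auto
  moreover have "card {K \<in> irr_classes (stab n x). \<forall>V \<in> K. fs_indicator n x V = 1}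
      = card {z :: complex. z ^ m = 1 \<and> P z}"
    unfolding m_def using P by (intro card_irr_classes[OF t(1) x]) auto
  moreover have "card {z :: complex. z ^ m = 1 \<and> \<not> P z} + card {z :: complex. z ^ m = 1 \<and> P z} = m"
  proof -
    have fin: "finite {z :: complex. z ^ m = 1}" using m by (intro finite_nth_roots)
    have "card {z :: complex. z ^ m = 1 \<and> \<not> P z} + card {z :: complex. z ^ m = 1 \<and> P z}
        = card ({z :: complex. z ^ m = 1 \<and> \<not> P z} \<union> {z. z ^ m = 1 \<and> P z})"
      by (rule card_Un_disjoint[symmetric]) (use fin in auto)
    also have "{z :: complex. z ^ m = 1 \<and> \<not> P z} \<union> {z. z ^ m = 1 \<and> P z} = {z. z ^ m = 1}" by auto
    finally show ?thesis using card_roots_unity_eq[OF m] by simp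
  qed
  ultimately show ?thesis by (simp add: m_def)
qed

text \<open>After interchanging the sums, the inner one counts the points on the orbits in
  \<open>orbits_at n t r j\<close>, which is \<open>t\<close> for each orbit. The formula includes
  the cases \<open>t = 1\<close> and \<open>t = n\<close>.\<close>

lemma num_irr_1_eq:
  assumes t: "t dvd n" "odd t"
  shows "num_irr n t 1 =
    t * (\<Sum>j \<in> E (n div t). \<Sum>r = 1..t. alpha j (n div t) * card (orbits_at n t r j))"
proof -
  have finM: "finite (M n t)" by (rule finite_subset[OF M_subset_Stb finite_Stb])
  have t0: "0 < t" using t(2) by (rule odd_pos)
  have "num_irr n t 1 = (\<Sum>x \<in> M n t. \<Sum>j \<in> E (n div t). \<Sum>r = 1..t.
      alpha j (n div t) * (if orb n x \<in> orbits_at n t r j then 1 else 0))"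
    unfolding num_irr_eq[OF t(1)] by (intro sum.cong refl card_classes_indicator_1[OF t])
  also have "\<dots> = (\<Sum>j \<in> E (n div t). \<Sum>r = 1..t. \<Sum>x \<in> M n t.
      alpha j (n div t) * (if orb n x \<in> orbits_at n t r j then 1 else 0))"
    by (subst sum.swap) (intro sum.cong refl, rule sum.swap)
  also have "\<dots> = (\<Sum>j \<in> E (n div t). \<Sum>r = 1..t. alpha j (n div t) * (t * card (orbits_at n t r j)))"
  proof (intro sum.cong refl)
    fix j r
    have "(\<Sum>x \<in> M n t. alpha j (n div t) * (if orb n x \<in> orbits_at n t r j then 1 else 0))
        = alpha j (n div t) * (\<Sum>x \<in> M n t. if orb n x \<in> orbits_at n t r j then 1 else 0)"
      by (simp only: sum_distrib_left)
    also have "(\<Sum>x \<in> M n t. if orb n x \<in> orbits_at n t r j then 1 else 0)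
        = card {x \<in> M n t. orb n x \<in> orbits_at n t r j}"
      using finM by (simp add: sum.If_cases Int_def)
    also have "\<dots> = t * card (orbits_at n t r j)"
      by (rule card_M_with_orb_in[OF t(1) t0]) (auto simp: orbits_at_def orbits_def)
    finally show "(\<Sum>x \<in> M n t. alpha j (n div t) * (if orb n x \<in> orbits_at n t r j then 1 else 0))
        = alpha j (n div t) * (t * card (orbits_at n t r j))" .
  qed
  also have "\<dots> = t * (\<Sum>j \<in> E (n div t). \<Sum>r = 1..t. alpha j (n div t) * card (orbits_at n t r j))"
    by (simp only: sum_distrib_left mult.left_commute)
  finally show ?thesis .
qed

lemma num_irr_0_eq:
  assumes t: "t dvd n" "odd t"
  shows "num_irr n t 0 + num_irr n t 1 = n div t * card (M n t)"
proof -
  have "num_irr n t 0 + num_irr n t 1 = (\<Sum>x \<in> M n t. n div t)"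
    unfolding num_irr_eq[OF t(1)] sum.distrib[symmetric] using card_classes_indicator[OF t]
    by (rule sum.cong[OF refl])
  then show ?thesis by simp
qed

section \<open>The extreme orbit lengths 1 and \<open>n\<close>\<close>

text \<open>Since \<open>rot i n = i\<close>, the relation evaluated at \<open>n\<close> gives
  \<open>x i = rot (j * i) n\<close>, leaving no freedom.\<close>

lemma automorphism_eqI:
  assumes x: "x \<in> Stb n" "\<And>r. x \<circ> rot r = rot (j * r) \<circ> x"
    and y: "y \<in> Stb n" "\<And>r. y \<circ> rot r = rot (j * r) \<circ> y"
  shows "x = y"
proof
  fix i
  show "x i = y i"
  proof (cases "i \<in> {1..n}")
    case True
    have "x i = (x \<circ> rot i) n" "y i = (y \<circ> rot i) n" using rot_self[OF True] by auto
    then show ?thesis unfolding x(2) y(2) using x(1) y(1) by (simp add: Stb_iff)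
  next
    case False
    then show ?thesis using x(1) y(1) unfolding Stb_iff by (metis permutes_not_in)
  qed
qed

text \<open>The witness is multiplication by \<open>j\<close> on the integers modulo
  \<open>n\<close>, with values normalized to \<open>{1..n}\<close> by evaluating a rotation at
  \<open>n\<close>. It is its own inverse because \<open>j\<close> squares to 1.\<close>

lemma ex_automorphism_involution:
  assumes j: "j \<in> E n"
  obtains x where "x \<in> involutions n" "\<And>r. x \<circ> rot r = rot (j * r) \<circ> x"
proof -
  define x where "x i = (if i \<in> {1..n} then rot (j * i) n else i)" for i
  have jj: "[j * j = 1] (mod n)" using j by (simp add: E_def power2_eq_square)
  have n_in: "n \<in> {1..n}" using n_pos by (simp add: Suc_le_eq One_nat_def)
  have x_in: "x i \<in> {1..n}" if "i \<in> {1..n}" for i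
    unfolding x_def using rot_in[OF n_in] that by simp
  have x_cong: "[x i = j * i] (mod n)" if "i \<in> {1..n}" for i
    unfolding x_def using rot_n_cong that by simp
  have xx: "x (x i) = i" for i
  proof (cases "i \<in> {1..n}")
    case True
    have "[x (x i) = j * x i] (mod n)" by (rule x_cong[OF x_in[OF True]])
    also have "[j * x i = j * (j * i)] (mod n)" by (intro cong_mult x_cong True cong_refl)
    also have "[j * (j * i) = 1 * i] (mod n)"
      unfolding mult.assoc[symmetric] by (intro cong_mult jj cong_refl)
    finally show ?thesis using True x_in by (intro cong_in_interval_imp_eq[of _ n]) auto
  qed (auto simp: x_def)
  have "bij_betw x {1..n} {1..n}"
    using xx x_in by (intro bij_betw_byWitness[where f' = x]) auto
  then have "x permutes {1..n}" by (rule bij_imp_permutes) (auto simp: x_def)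
  moreover have "x n = n"
    using x_cong[OF n_in] x_in[OF n_in] n_in
    by (intro cong_in_interval_imp_eq[of _ n]) (auto simp: cong_def)
  ultimately have "x \<in> involutions n" using xx by (auto simp: involutions_def Stb_iff)
  moreover have "x \<circ> rot r = rot (j * r) \<circ> x" for r
  proof
    fix i
    show "(x \<circ> rot r) i = (rot (j * r) \<circ> x) i"
    proof (cases "i \<in> {1..n}")
      case True
      have "[x (rot r i) = j * rot r i] (mod n)" by (rule x_cong[OF rot_in[OF True]])
      also have "[j * rot r i = j * (i + r)] (mod n)" by (intro cong_mult rot_cong True cong_refl)
      also have "j * (i + r) = j * i + j * r" by (rule add_mult_distrib2)
      also have "[j * i + j * r = x i + j * r] (mod n)"
        by (intro cong_add cong_refl cong_sym[OF x_cong[OF True]])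
      also have "[x i + j * r = rot (j * r) (x i)] (mod n)"
        by (rule cong_sym[OF rot_cong[OF x_in[OF True]]])
      finally have "[x (rot r i) = rot (j * r) (x i)] (mod n)" .
      then have "x (rot r i) = rot (j * r) (x i)"
        using True x_in rot_in by (intro cong_in_interval_imp_eq[of _ n]) auto
      then show ?thesis by simp
    next
      case False
      then have "x i = i" by (auto simp: x_def)
      then show ?thesis using rot_outside[OF False] by simp
    qed
  qed
  ultimately show thesis using that by blast
qed

text \<open>An orbit of length 1 is a permutation commuting with the rotations up to a multiplier.
  Its value at 1 fixes the multiplier as \<open>j\<close>, so multiplication by \<open>j\<close> is
  the only possibility.\<close>

lemma card_orbits_at_1:
  assumes j: "j \<in> E n"
  shows "card (orbits_at n 1 1 j) = 1"
proof -
  obtain x where x: "x \<in> involutions n" "\<And>r. x \<circ> rot r = rot (j * r) \<circ> x"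
    using ex_automorphism_involution[OF j] by blast
  have xS: "x \<in> Stb n" using x(1) by (simp add: involutions_def)
  have "ract n x (rot r) = x" for r
    by (rule act_eqI(2)[OF rot_in_Cyc xS x(2)])
  then have orb_x: "orb n x = {x}" by (auto simp: orb_eq)
  have "orbits_at n 1 1 j = {{x}}"
  proof (intro equalityI subsetI)
    fix Q assume Q: "Q \<in> orbits_at n 1 1 j"
    then obtain y where y: "y \<in> Stb n" "Q = orb n y" "card Q = 1" "card (Q \<inter> involutions n) = 1"
      by (auto simp: orbits_at_def orbits_def)
    have Qy: "Q = {y}" using self_in_orb[OF y(1)] y(2,3) by (metis card_1_singletonE singletonD)
    have y1: "[y 1 = j * 1] (mod n)" using Q by (simp add: Qy orbits_at_def)
    have yM: "y \<in> M n 1" using M_iff_card_orb[of 1] y by simp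
    have y_inv: "y \<circ> y = id" using y(4) unfolding Qy
      by (cases "y \<in> involutions n") (auto simp: involutions_def)
    obtain i where i: "i \<in> E (n div 1)" "\<And>k. lact n y (rot (1 * k)) = rot (1 * (i * k))"
      "\<And>z. z \<in> orb n y \<Longrightarrow> [z 1 = i * 1] (mod n)"
      using ex_multiplier[OF one_dvd yM y_inv] by blast
    have "i = j"
      using multiplier_unique[OF one_dvd _ y1 i(1) i(3)[OF self_in_orb[OF y(1)]]] j by simp
    then have "lact n y (rot r) = rot (j * r)" for r using i(2)[of r] by simp
    moreover have "ract n y (rot r) = y" for r using M_iff[OF one_dvd] yM by simp
    ultimately have "y \<circ> rot r = rot (j * r) \<circ> y" for r
      using act(1)[OF y(1) rot_in_Cyc[of r]] by simp
    then have "y = x" using automorphism_eqI[OF y(1) _ xS x(2)] by blast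
    then show "Q \<in> {{x}}" using Qy by simp
  next
    fix Q assume "Q \<in> {{x}}"
    then have Q: "Q = {x}" by simp
    have "n \<in> {1..n}" "1 \<in> {1..n}" using n_pos by (auto simp: Suc_le_eq One_nat_def)
    have "x 1 = (x \<circ> rot 1) n" using rot_self[OF \<open>1 \<in> {1..n}\<close>] by simp
    also have "\<dots> = rot (j * 1) n" unfolding x(2) using xS by (simp add: Stb_iff)
    finally have "[x 1 = j * 1] (mod n)" using rot_n_cong by simp
    moreover have "{x} \<in> orb n ` Stb n" using orb_x xS by blast
    ultimately show "Q \<in> orbits_at n 1 1 j" using x(1) by (simp add: Q orbits_at_def orbits_def)
  qed
  then show ?thesis by simp
qed

text \<open>For \<open>t = n\<close> and \<open>j = 1\<close> the congruence only says that
  \<open>y\<close> fixes \<open>n\<close>, which all elements of \<open>Stb n\<close> do.\<close>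

lemma orbits_at_n: "orbits_at n n r 1 = orbits n n r"
proof -
  have "[y n = n] (mod n)" if Q: "Q \<in> orbits n n r" "y \<in> Q" for Q y
  proof -
    obtain x where "x \<in> Stb n" "Q = orb n x" using Q(1) by (auto simp: orbits_def)
    then have "y \<in> Stb n" using orb_subset_Stb Q(2) by blast
    then show ?thesis by (simp add: Stb_iff)
  qed
  then show ?thesis by (auto simp: orbits_at_def)
qed

end

theorem theorem6p1p2:
  fixes n t :: nat
  assumes "n \<ge> 2" and "t dvd n" and "odd t"
  shows "(t = 1 \<longrightarrow> num_irr n t 1 = (\<Sum>j \<in> E (n div t). alpha j (n div t)))
    \<and> (1 < t \<and> t < n \<longrightarrow> num_irr n t 1 =
         t * (\<Sum>j \<in> E (n div t). \<Sum>r = 1..t. alpha j (n div t) * card (orbits_at n t r j)))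
    \<and> (t = n \<longrightarrow> num_irr n t 1 = n * (\<Sum>r = 1..n. card (orbits n n r)))
    \<and> int (num_irr n t 0) = int (n div t) * int (card (M n t)) - int (num_irr n t 1)"
proof (intro conjI impI)
  interpret symmetric_factorization n using assms(1) by unfold_locales simp
  \<comment> \<open>All three formulas are instances of this one; the extreme cases only need the
    orbit counts simplified.\<close>
  note eq = num_irr_1_eq[OF assms(2,3)]
  show "num_irr n t 1 = (\<Sum>j \<in> E (n div t). alpha j (n div t))" if t: "t = 1"
    unfolding eq unfolding t by (simp add: card_orbits_at_1)
  show "num_irr n t 1 =
         t * (\<Sum>j \<in> E (n div t). \<Sum>r = 1..t. alpha j (n div t) * card (orbits_at n t r j))"
    by (rule eq)
  show "num_irr n t 1 = n * (\<Sum>r = 1..n. card (orbits n n r))" if t: "t = n"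
  proof -
    \<comment> \<open>Modulo 1 there is a single residue, represented by 1 rather than 0, so the sum
      over \<open>j\<close> reduces to \<open>j = 1\<close>.\<close>
    have "n div n = 1" using assms(1) by simp
    moreover have "E 1 = {1}" by (auto simp: E_def)
    moreover have "alpha 1 1 = 1" by (simp add: alpha_def)
    ultimately show ?thesis unfolding eq unfolding t by (simp add: orbits_at_n del: One_nat_def)
  qed
  have "int (num_irr n t 0) + int (num_irr n t 1) = int (n div t) * int (card (M n t))"
    using num_irr_0_eq[OF assms(2,3)] by (metis of_nat_add of_nat_mult)
  then show "int (num_irr n t 0) = int (n div t) * int (card (M n t)) - int (num_irr n t 1)" by simp
qed

end
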